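(* Fix $c\in\mathbb R$, $\varepsilon>0$ and $\sigma\in\{-1,1\}$. Let $I$ be an interval and let $a\in C^\infty(I,(0,1))$ satisfy $R:=1-a^2-(a')^2>0$. With $Q=1+(c^2-1)a^2$, define $$b=\sqrt{1-a^2},\qquad F=\sqrt{\frac{\varepsilon Q}{a^2R}},\qquad T=\frac1{a^2Q}-\frac{a+a''}{aR}.$$ Let $(\ell_1,\ell_2)$ be the unique pair of positive functions with $\ell_1^{k_1}\ell_2^{k_2}=F$ and $d_2/\ell_2^2-d_1/\ell_1^2=T$, and choose phases with $$s_1'=\frac{\sigma\sqrt\varepsilon}{Fa^2},\qquad s_2'=\frac{\sigma c\sqrt\varepsilon}{Fb^2}.$$ Then $G=(ae^{is_1}f_1,be^{is_2}f_2)$ is harmonic for $g=dt^2+\ell_1^2g_1+\ell_2^2g_2$, and its profile curve $(ae^{is_1},be^{is_2})$ has unit speed. For fixed $(a,c,\varepsilon,\sigma)$ the reconstruction is unique up to additive constants in the phases. Conversely, every unit-speed harmonic spiral product with $a,b>0$ and $s_1'\ne0$ arises this way on its connected interval.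
   Context: Setting. For $i=1,2$, $(M_i,g_i)$ is a Riemannian manifold of dimension $k_i>0$, and $f_i:(M_i,g_i)\to\mathbb S^{2n_i+1}\subset\mathbb C^{n_i+1}$ (unit round sphere) is an eigenmap: a smooth map with $\Delta f_i=-d_if_i$, where $d_i=|df_i|^2>0$ is constant. A map $f$ into a unit sphere is harmonic iff $\Delta f=-|df|^2f$. For a smooth profile curve $\gamma=(ae^{is_1},be^{is_2})$ in $\mathbb S^3\subset\mathbb C^2$ with $a,b>0$, $a^2+b^2=1$, and smooth positive functions $\ell_1,\ell_2$ on an interval $I$ (source warps), set $G_\gamma=(ae^{is_1}f_1,be^{is_2}f_2):I\times M_1\times M_2\to\mathbb S^{2n_1+2n_2+3}$ and $g_\gamma=dt^2+\ell_1^2g_1+\ell_2^2g_2$; when $G_\gamma$ is harmonic for $g_\gamma$ it is called a harmonic spiral product, and it is unit-speed if $|\gamma'|=1$. For every $F>0$ and $T\in\mathbb R$ there is a unique positive pair $(\ell_1,\ell_2)$ with $\ell_1^{k_1}\ell_2^{k_2}=F$ and $d_2/\ell_2^2-d_1/\ell_1^2=T$, and it depends smoothly on $(F,T)$. *)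

theory Defs
  imports "HOL-Analysis.Analysis"
begin

section \<open>Smooth functions\<close>

text \<open>
  Derivatives are taken within the set, so that intervals with endpoints are covered by one-sided
  derivatives. On open sets, on nondegenerate intervals, and on products of such sets (the only
  sets used below) derivatives within the set are unique.
\<close>

primrec Ck_on :: "nat \<Rightarrow> 'a::real_normed_vector set \<Rightarrow> ('a \<Rightarrow> 'b::real_normed_vector) \<Rightarrow> bool" where
  "Ck_on 0 S f \<longleftrightarrow> continuous_on S f"
| "Ck_on (Suc n) S f \<longleftrightarrow>
     (\<exists>f'. (\<forall>x\<in>S. (f has_derivative f' x) (at x within S)) \<and> (\<forall>v. Ck_on n S (\<lambda>x. f' x v)))"

definition smooth_on :: "'a::real_normed_vector set \<Rightarrow> ('a \<Rightarrow> 'b::real_normed_vector) \<Rightarrow> bool" where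
  "smooth_on S f \<longleftrightarrow> (\<forall>n. Ck_on n S f)"

definition nondegenerate_interval :: "real set \<Rightarrow> bool" where
  "nondegenerate_interval I \<longleftrightarrow> is_interval I \<and> interior I \<noteq> {}"

abbreviation deriv_within :: "real set \<Rightarrow> (real \<Rightarrow> 'b::real_normed_vector) \<Rightarrow> real \<Rightarrow> 'b" where
  "deriv_within I f t \<equiv> vector_derivative f (at t within I)"

section \<open>Riemannian geometry in a coordinate domain\<close>

text \<open>
  A metric on a coordinate domain \<open>D\<close> assigns to each point a bilinear form on the model space.
\<close>

type_synonym 'e metric_field = "'e \<Rightarrow> 'e \<Rightarrow> 'e \<Rightarrow> real"

text \<open>The vector representing the covector \<open>\<alpha>\<close> with respect to the inner product \<open>h\<close>.\<close>

definition sharp :: "('e \<Rightarrow> 'e \<Rightarrow> real) \<Rightarrow> ('e \<Rightarrow> real) \<Rightarrow> 'e" where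
  "sharp h \<alpha> = (THE v. \<forall>w. h v w = \<alpha> w)"

text \<open>The entry \<open>g\<^sup>i\<^sup>j\<close> of the inverse metric, for coordinate vectors \<open>i\<close> and \<open>j\<close>.\<close>

definition inverse_metric :: "('e::euclidean_space \<Rightarrow> 'e \<Rightarrow> real) \<Rightarrow> 'e \<Rightarrow> 'e \<Rightarrow> real" where
  "inverse_metric h i j = sharp h (\<lambda>w. w \<bullet> i) \<bullet> j"

definition metric_trace ::
  "('e::euclidean_space \<Rightarrow> 'e \<Rightarrow> real) \<Rightarrow> ('e \<Rightarrow> 'e \<Rightarrow> 'b::real_vector) \<Rightarrow> 'b" where
  "metric_trace h B = (\<Sum>i\<in>Basis. \<Sum>j\<in>Basis. inverse_metric h i j *\<^sub>R B i j)"

abbreviation dir_deriv ::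
  "'e::euclidean_space set \<Rightarrow> ('e \<Rightarrow> 'b::real_normed_vector) \<Rightarrow> 'e \<Rightarrow> 'e \<Rightarrow> 'b" where
  "dir_deriv D u v x \<equiv> frechet_derivative u (at x within D) v"

text \<open>
  The Christoffel symbols of the Levi-Civita connection: \<open>christoffel D g x v w\<close> is the value at
  \<open>x\<close> of \<open>\<nabla>\<^sub>v w\<close> for constant fields \<open>v\<close>, \<open>w\<close> (Koszul formula).
\<close>

definition christoffel ::
  "'e::euclidean_space set \<Rightarrow> 'e metric_field \<Rightarrow> 'e \<Rightarrow> 'e \<Rightarrow> 'e \<Rightarrow> 'e" where
  "christoffel D g x v w = sharp (g x)
     (\<lambda>z. (dir_deriv D (\<lambda>y. g y w z) v x + dir_deriv D (\<lambda>y. g y v z) w x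
           - dir_deriv D (\<lambda>y. g y v w) z x) / 2)"

definition hessian ::
  "'e::euclidean_space set \<Rightarrow> 'e metric_field \<Rightarrow> ('e \<Rightarrow> 'b::real_normed_vector) \<Rightarrow> 'e \<Rightarrow> 'e \<Rightarrow> 'e \<Rightarrow> 'b"
  where
  "hessian D g u x v w =
     dir_deriv D (dir_deriv D u w) v x - dir_deriv D u (christoffel D g x v w) x"

text \<open>
  The Laplace--Beltrami operator with the sign for which it is the sum of second derivatives on
  Euclidean space; on vector-valued maps it acts componentwise.
\<close>

definition laplacian ::
  "'e::euclidean_space set \<Rightarrow> 'e metric_field \<Rightarrow> ('e \<Rightarrow> 'b::real_normed_vector) \<Rightarrow> 'e \<Rightarrow> 'b" where
  "laplacian D g u x = metric_trace (g x) (hessian D g u x)"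

text \<open>The squared norm \<open>|du|\<^sup>2\<close> of the differential.\<close>

definition energy_density ::
  "'e::euclidean_space set \<Rightarrow> 'e metric_field \<Rightarrow> ('e \<Rightarrow> 'b::real_inner) \<Rightarrow> 'e \<Rightarrow> real" where
  "energy_density D g u x = metric_trace (g x) (\<lambda>v w. dir_deriv D u v x \<bullet> dir_deriv D u w x)"

section \<open>Riemannian manifolds\<close>

text \<open>
  A chart is given by a local parametrization \<open>cpar\<close> on a coordinate domain \<open>cdom\<close>, together with
  the coordinate expression \<open>cmet\<close> of the metric. The dimension is \<open>DIM('e)\<close>, which is positive.
\<close>

record ('m, 'e) riem_chart =
  cdom :: "'e set"
  cpar :: "'e \<Rightarrow> 'm"
  cmet :: "'e metric_field"

record ('m, 'e) riem =
  rtop :: "'m topology"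
  atlas :: "('m, 'e) riem_chart set"

definition overlap :: "('m, 'e) riem_chart \<Rightarrow> ('m, 'e) riem_chart \<Rightarrow> 'e set" where
  "overlap c c' = {x \<in> cdom c. cpar c x \<in> cpar c' ` cdom c'}"

definition transition :: "('m, 'e) riem_chart \<Rightarrow> ('m, 'e) riem_chart \<Rightarrow> 'e \<Rightarrow> 'e" where
  "transition c c' = inv_into (cdom c') (cpar c') \<circ> cpar c"

definition local_metric :: "'e::euclidean_space set \<Rightarrow> 'e metric_field \<Rightarrow> bool" where
  "local_metric D g \<longleftrightarrow>
     (\<forall>v w. smooth_on D (\<lambda>x. g x v w)) \<and>
     (\<forall>x\<in>D. bilinear (g x) \<and> (\<forall>v w. g x v w = g x w v) \<and> (\<forall>v. v \<noteq> 0 \<longrightarrow> g x v v > 0))"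

definition riemannian_manifold :: "('m, 'e::euclidean_space) riem \<Rightarrow> bool" where
  "riemannian_manifold N \<longleftrightarrow>
     topspace (rtop N) \<noteq> {} \<and> Hausdorff_space (rtop N) \<and> second_countable (rtop N) \<and>
     (\<Union>c\<in>atlas N. cpar c ` cdom c) = topspace (rtop N) \<and>
     (\<forall>c\<in>atlas N. open (cdom c) \<and> openin (rtop N) (cpar c ` cdom c) \<and>
        homeomorphic_map (top_of_set (cdom c)) (subtopology (rtop N) (cpar c ` cdom c)) (cpar c) \<and>
        local_metric (cdom c) (cmet c)) \<and>
     (\<forall>c\<in>atlas N. \<forall>c'\<in>atlas N.
        smooth_on (overlap c c') (transition c c') \<and>
        (\<forall>x\<in>overlap c c'. \<forall>v w. cmet c x v w =
           cmet c' (transition c c' x)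
             (frechet_derivative (transition c c') (at x) v)
             (frechet_derivative (transition c c') (at x) w)))"

definition smooth_map :: "('m, 'e::euclidean_space) riem \<Rightarrow> ('m \<Rightarrow> 'b::real_normed_vector) \<Rightarrow> bool" where
  "smooth_map N f \<longleftrightarrow> (\<forall>c\<in>atlas N. smooth_on (cdom c) (f \<circ> cpar c))"

text \<open>Smooth maps into the unit sphere of a Euclidean space.\<close>

definition smooth_sphere_map :: "('m, 'e::euclidean_space) riem \<Rightarrow> ('m \<Rightarrow> 'b::euclidean_space) \<Rightarrow> bool" where
  "smooth_sphere_map N f \<longleftrightarrow> smooth_map N f \<and> f ` topspace (rtop N) \<subseteq> sphere 0 1"

text \<open>Eigenmaps: \<open>\<Delta>f = -d f\<close> with \<open>d = |df|\<^sup>2 > 0\<close> constant, checked in every chart.\<close>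

definition eigenmap :: "('m, 'e::euclidean_space) riem \<Rightarrow> real \<Rightarrow> ('m \<Rightarrow> 'b::euclidean_space) \<Rightarrow> bool" where
  "eigenmap N d f \<longleftrightarrow> smooth_sphere_map N f \<and> d > 0 \<and>
     (\<forall>c\<in>atlas N. \<forall>x\<in>cdom c.
        energy_density (cdom c) (cmet c) (f \<circ> cpar c) x = d \<and>
        laplacian (cdom c) (cmet c) (f \<circ> cpar c) x = - d *\<^sub>R f (cpar c x))"

text \<open>Harmonicity of a map into a unit sphere: \<open>\<Delta>f = -|df|\<^sup>2 f\<close>.\<close>

definition harmonic_sphere_map :: "('m, 'e::euclidean_space) riem \<Rightarrow> ('m \<Rightarrow> 'b::euclidean_space) \<Rightarrow> bool" where
  "harmonic_sphere_map N f \<longleftrightarrow> smooth_sphere_map N f \<and>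
     (\<forall>c\<in>atlas N. \<forall>x\<in>cdom c.
        laplacian (cdom c) (cmet c) (f \<circ> cpar c) x =
          - energy_density (cdom c) (cmet c) (f \<circ> cpar c) x *\<^sub>R f (cpar c x))"

section \<open>Spiral products\<close>

text \<open>
  The source \<open>I \<times> M\<^sub>1 \<times> M\<^sub>2\<close> with metric \<open>dt\<^sup>2 + l1\<^sup>2 g\<^sub>1 + l2\<^sup>2 g\<^sub>2\<close>, given by its product charts. If \<open>I\<close>
  contains an endpoint, the chart domains contain boundary points.
\<close>

definition warped_chart ::
  "real set \<Rightarrow> (real \<Rightarrow> real) \<Rightarrow> (real \<Rightarrow> real) \<Rightarrow> ('m1, 'e1) riem_chart \<Rightarrow> ('m2, 'e2) riem_chart
   \<Rightarrow> (real \<times> 'm1 \<times> 'm2, real \<times> 'e1 \<times> 'e2) riem_chart" where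
  "warped_chart I l1 l2 c1 c2 =
     \<lparr> cdom = I \<times> cdom c1 \<times> cdom c2,
       cpar = (\<lambda>(t, x, y). (t, cpar c1 x, cpar c2 y)),
       cmet = (\<lambda>(t, x, y) (r, v, w) (r', v', w').
                 r * r' + (l1 t)\<^sup>2 * cmet c1 x v v' + (l2 t)\<^sup>2 * cmet c2 y w w') \<rparr>"

definition warped_source ::
  "real set \<Rightarrow> (real \<Rightarrow> real) \<Rightarrow> (real \<Rightarrow> real) \<Rightarrow> ('m1, 'e1) riem \<Rightarrow> ('m2, 'e2) riem
   \<Rightarrow> (real \<times> 'm1 \<times> 'm2, real \<times> 'e1 \<times> 'e2) riem" where
  "warped_source I l1 l2 N1 N2 =
     \<lparr> rtop = prod_topology (top_of_set I) (prod_topology (rtop N1) (rtop N2)),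
       atlas = {warped_chart I l1 l2 c1 c2 | c1 c2. c1 \<in> atlas N1 \<and> c2 \<in> atlas N2} \<rparr>"

definition profile_curve ::
  "(real \<Rightarrow> real) \<Rightarrow> (real \<Rightarrow> real) \<Rightarrow> (real \<Rightarrow> real) \<Rightarrow> (real \<Rightarrow> real) \<Rightarrow> real \<Rightarrow> complex \<times> complex" where
  "profile_curve a b s1 s2 t =
     (complex_of_real (a t) * cis (s1 t), complex_of_real (b t) * cis (s2 t))"

text \<open>The norm of \<open>complex \<times> complex\<close> is the Euclidean one.\<close>

definition unit_speed ::
  "real set \<Rightarrow> (real \<Rightarrow> real) \<Rightarrow> (real \<Rightarrow> real) \<Rightarrow> (real \<Rightarrow> real) \<Rightarrow> (real \<Rightarrow> real) \<Rightarrow> bool" where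
  "unit_speed I a b s1 s2 \<longleftrightarrow> (\<forall>t\<in>I. norm (deriv_within I (profile_curve a b s1 s2) t) = 1)"

definition spiral_product ::
  "(real \<Rightarrow> real) \<Rightarrow> (real \<Rightarrow> real) \<Rightarrow> (real \<Rightarrow> real) \<Rightarrow> (real \<Rightarrow> real)
   \<Rightarrow> ('m1 \<Rightarrow> complex ^ 'n1) \<Rightarrow> ('m2 \<Rightarrow> complex ^ 'n2)
   \<Rightarrow> real \<times> 'm1 \<times> 'm2 \<Rightarrow> (complex ^ 'n1) \<times> (complex ^ 'n2)" where
  "spiral_product a b s1 s2 f1 f2 = (\<lambda>(t, p, q).
     (fst (profile_curve a b s1 s2 t) *s f1 p, snd (profile_curve a b s1 s2 t) *s f2 q))"

definition harmonic_spiral_product ::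
  "real set \<Rightarrow> ('m1, 'e1::euclidean_space) riem \<Rightarrow> ('m2, 'e2::euclidean_space) riem
   \<Rightarrow> ('m1 \<Rightarrow> complex ^ 'n1) \<Rightarrow> ('m2 \<Rightarrow> complex ^ 'n2)
   \<Rightarrow> (real \<Rightarrow> real) \<Rightarrow> (real \<Rightarrow> real) \<Rightarrow> (real \<Rightarrow> real) \<Rightarrow> (real \<Rightarrow> real)
   \<Rightarrow> (real \<Rightarrow> real) \<Rightarrow> (real \<Rightarrow> real) \<Rightarrow> bool" where
  "harmonic_spiral_product I N1 N2 f1 f2 a b s1 s2 l1 l2 \<longleftrightarrow>
     smooth_on I a \<and> smooth_on I b \<and> smooth_on I s1 \<and> smooth_on I s2 \<and>
     (\<forall>t\<in>I. a t > 0 \<and> b t > 0 \<and> (a t)\<^sup>2 + (b t)\<^sup>2 = 1) \<and>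
     smooth_on I l1 \<and> smooth_on I l2 \<and> (\<forall>t\<in>I. l1 t > 0 \<and> l2 t > 0) \<and>
     harmonic_sphere_map (warped_source I l1 l2 N1 N2) (spiral_product a b s1 s2 f1 f2)"

section \<open>Reconstruction from the radial function\<close>

definition radial_R :: "real set \<Rightarrow> (real \<Rightarrow> real) \<Rightarrow> real \<Rightarrow> real" where
  "radial_R I a t = 1 - (a t)\<^sup>2 - (deriv_within I a t)\<^sup>2"

definition radial_Q :: "real \<Rightarrow> (real \<Rightarrow> real) \<Rightarrow> real \<Rightarrow> real" where
  "radial_Q c a t = 1 + (c\<^sup>2 - 1) * (a t)\<^sup>2"

definition radial_F :: "real set \<Rightarrow> real \<Rightarrow> real \<Rightarrow> (real \<Rightarrow> real) \<Rightarrow> real \<Rightarrow> real" where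
  "radial_F I c \<epsilon> a t = sqrt (\<epsilon> * radial_Q c a t / ((a t)\<^sup>2 * radial_R I a t))"

definition radial_T :: "real set \<Rightarrow> real \<Rightarrow> (real \<Rightarrow> real) \<Rightarrow> real \<Rightarrow> real" where
  "radial_T I c a t = 1 / ((a t)\<^sup>2 * radial_Q c a t)
     - (a t + deriv_within I (deriv_within I a) t) / (a t * radial_R I a t)"

definition admissible_radius :: "real set \<Rightarrow> (real \<Rightarrow> real) \<Rightarrow> bool" where
  "admissible_radius I a \<longleftrightarrow> smooth_on I a \<and> (\<forall>t\<in>I. 0 < a t \<and> a t < 1 \<and> radial_R I a t > 0)"

text \<open>
  \<open>reconstruction I k1 k2 d1 d2 c \<epsilon> \<sigma> a b l1 l2 s1 s2\<close>: the functions \<open>b\<close>, \<open>l1\<close>, \<open>l2\<close>, \<open>s1\<close>, \<open>s2\<close> are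
  obtained on \<open>I\<close> from the data \<open>a\<close>, \<open>c\<close>, \<open>\<epsilon>\<close>, \<open>\<sigma>\<close>.
\<close>

definition reconstruction ::
  "real set \<Rightarrow> nat \<Rightarrow> nat \<Rightarrow> real \<Rightarrow> real \<Rightarrow> real \<Rightarrow> real \<Rightarrow> real
   \<Rightarrow> (real \<Rightarrow> real) \<Rightarrow> (real \<Rightarrow> real) \<Rightarrow> (real \<Rightarrow> real) \<Rightarrow> (real \<Rightarrow> real)
   \<Rightarrow> (real \<Rightarrow> real) \<Rightarrow> (real \<Rightarrow> real) \<Rightarrow> bool" where
  "reconstruction I k1 k2 d1 d2 c \<epsilon> \<sigma> a b l1 l2 s1 s2 \<longleftrightarrow> (\<forall>t\<in>I.
     b t = sqrt (1 - (a t)\<^sup>2) \<and>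
     l1 t > 0 \<and> l2 t > 0 \<and>
     l1 t ^ k1 * l2 t ^ k2 = radial_F I c \<epsilon> a t \<and>
     d2 / (l2 t)\<^sup>2 - d1 / (l1 t)\<^sup>2 = radial_T I c a t \<and>
     (s1 has_real_derivative \<sigma> * sqrt \<epsilon> / (radial_F I c \<epsilon> a t * (a t)\<^sup>2)) (at t within I) \<and>
     (s2 has_real_derivative \<sigma> * c * sqrt \<epsilon> / (radial_F I c \<epsilon> a t * (b t)\<^sup>2)) (at t within I))"

end

theory Submission
  imports Defs
begin

text \<open>
  In a product chart the warped metric is block diagonal, so for \<open>G = (z\<^sub>1 f\<^sub>1, z\<^sub>2 f\<^sub>2)\<close> with eigenmaps
  \<open>f\<^sub>i\<close> harmonicity reduces to \<open>z\<^sub>i'' + (F'/F) z\<^sub>i' + (|dG|\<^sup>2 - d\<^sub>i / l\<^sub>i\<^sup>2) z\<^sub>i = 0\<close> with \<open>F = l\<^sub>1\<^bsup>k\<^sub>1\<^esup> l\<^sub>2\<^bsup>k\<^sub>2\<^esup>\<close>.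
  In polar form the imaginary parts say that the momenta \<open>F a\<^sup>2 s\<^sub>1'\<close> and \<open>F b\<^sup>2 s\<^sub>2'\<close> are constant,
  equal to \<open>\<sigma> \<surd>\<epsilon>\<close> and \<open>\<sigma> c \<surd>\<epsilon>\<close>. Unit speed then amounts to \<open>F\<^sup>2 a\<^sup>2 R = \<epsilon> Q\<close>, and eliminating \<open>F'/F\<close>
  from the difference of the real parts by differentiating this relation gives the formula for \<open>T\<close>.
\<close>

section \<open>Calculus of smooth functions\<close>

text \<open>The elimination of F'/F never divides by a'. Differentiating the radial relation gives
  F'/F as a' times an expression in a, a'', R, Q and c, while in the difference of the real parts
  F'/F is multiplied by b'/b - a'/a = -a'/(a b^2). So a' enters only through a'^2 = b^2 - R, and the
  formula for T holds at critical points of a as well.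

  The two directions share this computation and differ in where its inputs come from. In the
  reconstruction the momenta are constant by the choice of the phases and the radial relation holds
  by the choice of F. In the converse the momenta are found by integration, and R > 0 is read off
  from the radial relation because Q > 0.

  Two features of the definitions shape the rest. The interval may contain endpoints, so product
  chart domains need not be open, every derivative is taken within a set and its uniqueness has to
  be secured. And \<open>reconstruction\<close> constrains the warps only pointwise, so their
  smoothness must come from a smooth solution of the two warp equations together with
  uniqueness.\<close>

lemma Ck_on_cong:
  assumes "\<And>x. x \<in> S \<Longrightarrow> f x = g x"
  shows "Ck_on n S f \<longleftrightarrow> Ck_on n S g"
proof (cases n)
  case 0
  then show ?thesis using assms by (simp cong: continuous_on_cong)
next
  case (Suc m)
  have "(f has_derivative f') (at x within S) \<longleftrightarrow> (g has_derivative f') (at x within S)"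
    if "x \<in> S" for x f'
    by (rule iffI; erule has_derivative_transform[rotated 2]) (use that assms in auto)
  then show ?thesis using Suc by simp
qed

lemma Ck_on_Suc_imp: "Ck_on (Suc n) S f \<Longrightarrow> Ck_on n S f"
proof (induction n arbitrary: f)
  case 0
  then show ?case by (auto intro: has_derivative_continuous_on)
next
  case (Suc n)
  then show ?case by (metis Ck_on.simps(2))
qed

lemma linear_real_arg: "linear (f :: real \<Rightarrow> 'b::real_vector) \<Longrightarrow> f v = v *\<^sub>R f 1"
  using linear_scale[of f v 1] by simp

section \<open>Closure properties of C^n and smooth functions\<close>

lemma Ck_on_const: "Ck_on n S (\<lambda>_. c)"
proof (induction n arbitrary: c)
  case (Suc n)
  have "\<forall>x\<in>S. ((\<lambda>_. c) has_derivative (\<lambda>_. 0)) (at x within S)" by simp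
  then show ?case using Suc by (auto intro!: exI[of _ "\<lambda>_ _. 0"])
qed simp

lemma Ck_on_bounded_linear:
  assumes L: "bounded_linear L"
  shows "Ck_on n S f \<Longrightarrow> Ck_on n S (\<lambda>x. L (f x))"
proof (induction n arbitrary: f)
  case 0
  then show ?case by (simp add: bounded_linear.continuous_on[OF L])
next
  case (Suc n)
  then obtain f' where f': "\<forall>x\<in>S. (f has_derivative f' x) (at x within S)"
    "\<forall>v. Ck_on n S (\<lambda>x. f' x v)" by auto
  show ?case unfolding Ck_on.simps
    by (intro exI[of _ "\<lambda>x v. L (f' x v)"] conjI ballI allI Suc.IH
        bounded_linear.has_derivative[OF L]) (use f' in simp_all)
qed

lemma Ck_on_add: "Ck_on n S f \<Longrightarrow> Ck_on n S g \<Longrightarrow> Ck_on n S (\<lambda>x. f x + g x)"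
proof (induction n arbitrary: f g)
  case 0
  then show ?case by (simp add: continuous_on_add)
next
  case (Suc n)
  obtain f' where f': "\<forall>x\<in>S. (f has_derivative f' x) (at x within S)"
    "\<forall>v. Ck_on n S (\<lambda>x. f' x v)" using Suc.prems(1) by auto
  obtain g' where g': "\<forall>x\<in>S. (g has_derivative g' x) (at x within S)"
    "\<forall>v. Ck_on n S (\<lambda>x. g' x v)" using Suc.prems(2) by auto
  show ?case unfolding Ck_on.simps
    by (intro exI[of _ "\<lambda>x v. f' x v + g' x v"] conjI ballI allI Suc.IH has_derivative_add)
       (use f' g' in simp_all)
qed

text \<open>Each of the two Leibniz terms pairs an undifferentiated factor with a derivative, so the
  induction hypothesis applies once f and g themselves are known at level n.\<close>

lemma Ck_on_bilinear:
  assumes B: "bounded_bilinear B"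
  shows "Ck_on n S f \<Longrightarrow> Ck_on n S g \<Longrightarrow> Ck_on n S (\<lambda>x. B (f x) (g x))"
proof (induction n arbitrary: f g)
  case 0
  then show ?case by (simp add: bounded_bilinear.continuous_on[OF B])
next
  case (Suc n)
  obtain f' where f': "\<forall>x\<in>S. (f has_derivative f' x) (at x within S)"
    "\<forall>v. Ck_on n S (\<lambda>x. f' x v)" using Suc.prems(1) by auto
  obtain g' where g': "\<forall>x\<in>S. (g has_derivative g' x) (at x within S)"
    "\<forall>v. Ck_on n S (\<lambda>x. g' x v)" using Suc.prems(2) by auto
  have n: "Ck_on n S f" "Ck_on n S g" using Suc.prems Ck_on_Suc_imp by blast+
  show ?case unfolding Ck_on.simps
    by (intro exI[of _ "\<lambda>x v. B (f x) (g' x v) + B (f' x v) (g x)"] conjI ballI allI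
        Ck_on_add Suc.IH bounded_bilinear.FDERIV[OF B]) (use f' g' n in simp_all)
qed

text \<open>In a general composition f' is evaluated in the direction g' x v, which varies with x,
  whereas \<open>Ck_on\<close> controls derivatives in fixed directions only. For a linear inner map
  the direction \<open>L v\<close> is fixed and the induction closes.\<close>

lemma Ck_on_comp_linear:
  assumes L: "bounded_linear L" and sub: "\<And>x. x \<in> S \<Longrightarrow> L x \<in> U"
  shows "Ck_on n U f \<Longrightarrow> Ck_on n S (\<lambda>x. f (L x))"
proof (induction n arbitrary: f)
  case 0
  then show ?case
    using sub by (auto intro!: continuous_on_compose2[of U f] linear_continuous_on[OF L])
next
  case (Suc n)
  then obtain f' where f': "\<forall>x\<in>U. (f has_derivative f' x) (at x within U)"
    "\<forall>v. Ck_on n U (\<lambda>x. f' x v)" by auto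
  have "((\<lambda>x. f (L x)) has_derivative (\<lambda>v. f' (L x) (L v))) (at x within S)" if "x \<in> S" for x
  proof -
    have "(f has_derivative f' (L x)) (at (L x) within L ` S)"
      using f' that sub by (meson has_derivative_subset image_subsetI)
    then show ?thesis
      using has_derivative_in_compose[OF bounded_linear_imp_has_derivative[OF L]] by blast
  qed
  then show ?case unfolding Ck_on.simps
    by (intro exI[of _ "\<lambda>x v. f' (L x) (L v)"]) (use f' Suc.IH[of "\<lambda>x. f' x _"] in auto)
qed

text \<open>With a real variable in between, linearity reduces every direction to 1: the derivative
  is the scalar \<open>g' x v\<close> times \<open>f' (g x) 1\<close>. This is a product of
  functions to which \<open>Ck_on_bilinear\<close> and the induction hypothesis apply.\<close>

lemma Ck_on_comp_real:
  fixes f :: "real \<Rightarrow> 'b::real_normed_vector" and g :: "'a::real_normed_vector \<Rightarrow> real"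
  assumes sub: "\<And>x. x \<in> S \<Longrightarrow> g x \<in> U"
  shows "Ck_on n U f \<Longrightarrow> Ck_on n S g \<Longrightarrow> Ck_on n S (\<lambda>x. f (g x))"
proof (induction n arbitrary: f)
  case 0
  then show ?case using sub by (simp add: continuous_on_compose2[of U f S g] image_subset_iff)
next
  case (Suc n)
  obtain f' where f': "\<forall>x\<in>U. (f has_derivative f' x) (at x within U)"
    "\<forall>v. Ck_on n U (\<lambda>x. f' x v)" using Suc.prems(1) by auto
  obtain g' where g': "\<forall>x\<in>S. (g has_derivative g' x) (at x within S)"
    "\<forall>v. Ck_on n S (\<lambda>x. g' x v)" using Suc.prems(2) by auto
  have n: "Ck_on n S g" by (rule Ck_on_Suc_imp[OF Suc.prems(2)])
  have "((\<lambda>x. f (g x)) has_derivative (\<lambda>v. g' x v *\<^sub>R f' (g x) 1)) (at x within S)"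
    if "x \<in> S" for x
  proof -
    have "(f has_derivative f' (g x)) (at (g x) within g ` S)"
      by (rule has_derivative_subset[OF f'(1)[rule_format, OF sub[OF that]]]) (use sub in \<open>simp add: image_subset_iff\<close>)
    then have "((\<lambda>x. f (g x)) has_derivative (\<lambda>v. f' (g x) (g' x v))) (at x within S)"
      by (rule has_derivative_in_compose[OF g'(1)[rule_format, OF that]])
    moreover have "f' (g x) (g' x v) = g' x v *\<^sub>R f' (g x) 1" for v
      by (rule linear_real_arg[OF has_derivative_linear[OF f'(1)[rule_format, OF sub[OF that]]]])
    ultimately show ?thesis by simp
  qed
  moreover have "Ck_on n S (\<lambda>x. g' x v *\<^sub>R f' (g x) 1)" for v
    by (rule Ck_on_bilinear[OF bounded_bilinear_scaleR g'(2)[rule_format]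
          Suc.IH[OF f'(2)[rule_format] n]])
  ultimately show ?case unfolding Ck_on.simps
    by (intro exI[of _ "\<lambda>x v. g' x v *\<^sub>R f' (g x) 1"] conjI ballI allI)
qed

lemma Ck_on_SucI_real:
  fixes f :: "real \<Rightarrow> 'b::real_normed_vector"
  assumes "\<And>t. t \<in> S \<Longrightarrow> (f has_vector_derivative f' t) (at t within S)" and "Ck_on n S f'"
  shows "Ck_on (Suc n) S f"
  unfolding Ck_on.simps
  by (intro exI[of _ "\<lambda>t v. v *\<^sub>R f' t"] conjI ballI allI
      Ck_on_bounded_linear[OF bounded_linear_scaleR_right])
     (use assms in \<open>simp_all add: has_vector_derivative_def\<close>)

lemma Ck_on_of_smooth:
  "smooth_on S f \<Longrightarrow> Ck_on n S f"
  by (simp add: smooth_on_def)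

lemma smooth_on_cong:
  "(\<And>x. x \<in> S \<Longrightarrow> f x = g x) \<Longrightarrow> smooth_on S f \<longleftrightarrow> smooth_on S g"
  unfolding smooth_on_def by (simp add: Ck_on_cong[of S f g])

lemma smooth_on_const: "smooth_on S (\<lambda>_. c)"
  by (simp add: smooth_on_def Ck_on_const)

lemma smooth_on_bounded_linear: "bounded_linear L \<Longrightarrow> smooth_on S f \<Longrightarrow> smooth_on S (\<lambda>x. L (f x))"
  by (simp add: smooth_on_def Ck_on_bounded_linear)

lemma smooth_on_add: "smooth_on S f \<Longrightarrow> smooth_on S g \<Longrightarrow> smooth_on S (\<lambda>x. f x + g x)"
  by (simp add: smooth_on_def Ck_on_add)

lemma smooth_on_minus: "smooth_on S f \<Longrightarrow> smooth_on S (\<lambda>x. - f x)"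
  by (rule smooth_on_bounded_linear[OF bounded_linear_minus[OF bounded_linear_ident]])

lemma smooth_on_diff: "smooth_on S f \<Longrightarrow> smooth_on S g \<Longrightarrow> smooth_on S (\<lambda>x. f x - g x)"
  using smooth_on_add[of S f "\<lambda>x. - g x"] smooth_on_minus[of S g] by simp

lemma smooth_on_bilinear:
  "bounded_bilinear B \<Longrightarrow> smooth_on S f \<Longrightarrow> smooth_on S g \<Longrightarrow> smooth_on S (\<lambda>x. B (f x) (g x))"
  by (simp add: smooth_on_def Ck_on_bilinear)

lemma smooth_on_mult:
  fixes f g :: "'a::real_normed_vector \<Rightarrow> 'b::real_normed_algebra"
  shows "smooth_on S f \<Longrightarrow> smooth_on S g \<Longrightarrow> smooth_on S (\<lambda>x. f x * g x)"
  by (rule smooth_on_bilinear[OF bounded_bilinear_mult])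

lemma smooth_on_power:
  fixes f :: "'a::real_normed_vector \<Rightarrow> 'b::real_normed_algebra_1"
  shows "smooth_on S f \<Longrightarrow> smooth_on S (\<lambda>x. f x ^ n)"
  by (induction n) (simp_all add: smooth_on_const smooth_on_mult)

lemma smooth_on_comp_linear:
  "bounded_linear L \<Longrightarrow> (\<And>x. x \<in> S \<Longrightarrow> L x \<in> U) \<Longrightarrow> smooth_on U f \<Longrightarrow> smooth_on S (\<lambda>x. f (L x))"
  unfolding smooth_on_def by (simp add: Ck_on_comp_linear[of L S U])

lemma smooth_on_comp_real:
  fixes f :: "real \<Rightarrow> 'b::real_normed_vector"
  shows "(\<And>x. x \<in> S \<Longrightarrow> g x \<in> U) \<Longrightarrow> smooth_on U f \<Longrightarrow> smooth_on S g \<Longrightarrow> smooth_on S (\<lambda>x. f (g x))"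
  unfolding smooth_on_def by (simp add: Ck_on_comp_real[of S g U])

text \<open>If the derivative is built from f by operations that preserve C^n, then f gains one
  order of regularity at a time. Functions such as \<open>exp\<close>, \<open>cis\<close>,
  \<open>inverse\<close>, \<open>sqrt\<close> and smooth inverse functions satisfy equations of this
  kind.\<close>

lemma smooth_on_real_bootstrap:
  fixes f :: "real \<Rightarrow> 'b::real_normed_vector"
  assumes der: "\<And>t. t \<in> S \<Longrightarrow> (f has_vector_derivative f' t) (at t within S)"
    and boot: "\<And>n. Ck_on n S f \<Longrightarrow> Ck_on n S f'"
  shows "smooth_on S f"
  unfolding smooth_on_def
proof
  fix n show "Ck_on n S f"
  proof (induction n)
    case 0
    show ?case unfolding Ck_on.simps by (rule continuous_on_vector_derivative[OF der])
  next
    case (Suc n)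
    then show ?case by (intro Ck_on_SucI_real[OF der] boot)
  qed
qed

section \<open>Smoothness of elementary functions\<close>

lemma smooth_on_exp: "smooth_on S (exp :: real \<Rightarrow> real)"
  by (rule smooth_on_real_bootstrap[where f' = exp])
     (auto simp: has_real_derivative_iff_has_vector_derivative[symmetric] intro!: derivative_eq_intros)

lemma smooth_on_cis: "smooth_on S cis"
proof (rule smooth_on_real_bootstrap[where f' = "\<lambda>t. \<i> * cis t"])
  show "(cis has_vector_derivative \<i> * cis t) (at t within S)" for t
    unfolding has_vector_derivative_complex_iff
    by (auto simp: has_real_derivative_iff_has_vector_derivative[symmetric] intro!: derivative_eq_intros)
qed (rule Ck_on_bounded_linear[OF bounded_linear_mult_right])

lemma smooth_on_inverse_pos: "smooth_on {0<..} (inverse :: real \<Rightarrow> real)"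
proof (rule smooth_on_real_bootstrap[where f' = "\<lambda>t. - (inverse t * inverse t)"])
  show "(inverse has_vector_derivative - (inverse t * inverse t)) (at t within {0<..})"
    if "t \<in> {0<..}" for t :: real
    using that unfolding has_real_derivative_iff_has_vector_derivative[symmetric]
    by (auto intro!: derivative_eq_intros)
  show "Ck_on n {0<..} (\<lambda>t::real. - (inverse t * inverse t))"
    if "Ck_on n {0<..} (inverse :: real \<Rightarrow> real)" for n
    by (rule Ck_on_bounded_linear[of uminus, OF bounded_linear_minus[OF bounded_linear_ident]
          Ck_on_bilinear[OF bounded_bilinear_mult that that]])
qed

lemma smooth_on_sqrt_pos: "smooth_on {0<..} sqrt"
proof (rule smooth_on_real_bootstrap[where f' = "\<lambda>t. (1/2) * inverse (sqrt t)"])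
  show "(sqrt has_vector_derivative (1/2) * inverse (sqrt t)) (at t within {0<..})"
    if "t \<in> {0<..}" for t :: real
    using that unfolding has_real_derivative_iff_has_vector_derivative[symmetric]
    by (auto intro!: derivative_eq_intros simp: field_simps)
  show "Ck_on n {0<..} (\<lambda>t. (1/2) * inverse (sqrt t))" if "Ck_on n {0<..} sqrt" for n
    by (rule Ck_on_bounded_linear[OF bounded_linear_mult_right],
        rule Ck_on_comp_real[OF _ Ck_on_of_smooth[OF smooth_on_inverse_pos] that]) auto
qed

lemma smooth_on_ln_pos: "smooth_on {0<..} (ln :: real \<Rightarrow> real)"
proof (rule smooth_on_real_bootstrap[where f' = inverse])
  show "(ln has_vector_derivative inverse t) (at t within {0<..})" if "t \<in> {0<..}" for t :: real
    using that unfolding has_real_derivative_iff_has_vector_derivative[symmetric]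
    by (auto intro!: derivative_eq_intros simp: field_simps)
qed (rule Ck_on_of_smooth[OF smooth_on_inverse_pos])

lemma smooth_on_divide_pos:
  fixes f g :: "'a::real_normed_vector \<Rightarrow> real"
  assumes "smooth_on S f" "smooth_on S g" "\<And>x. x \<in> S \<Longrightarrow> 0 < g x"
  shows "smooth_on S (\<lambda>x. f x / g x)"
  unfolding divide_inverse
  by (rule smooth_on_mult[OF assms(1)], rule smooth_on_comp_real[OF _ smooth_on_inverse_pos assms(2)])
     (use assms(3) in auto)

section \<open>Derivatives within a nondegenerate interval\<close>

text \<open>A connected set with more than one point has no isolated points. This makes derivatives
  within the interval unique, endpoints included.\<close>

lemma at_within_interval_neq_bot:
  assumes "nondegenerate_interval I" "t \<in> I"
  shows "at t within I \<noteq> bot"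
proof -
  have "\<nexists>a. I = {a}" using assms(1) by (auto simp: nondegenerate_interval_def)
  then have "t islimpt I"
    using assms connected_imp_perfect[of I t] is_interval_connected
    by (auto simp: nondegenerate_interval_def)
  then show ?thesis by (simp add: trivial_limit_within)
qed

lemma deriv_within_eqI:
  assumes "nondegenerate_interval I" "t \<in> I" "(f has_vector_derivative y) (at t within I)"
  shows "deriv_within I f t = y"
  by (rule vector_derivative_within[OF at_within_interval_neq_bot[OF assms(1,2)] assms(3)])

lemma smooth_on_has_deriv_within:
  assumes I: "nondegenerate_interval I" and f: "smooth_on I f" and t: "t \<in> I"
  shows "(f has_vector_derivative deriv_within I f t) (at t within I)"
proof -
  have "Ck_on 1 I f" using f by (simp add: smooth_on_def)
  then have "f differentiable (at t within I)" using t by (auto simp: differentiable_def)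
  then show ?thesis
    by (simp add: vector_derivative_works)
qed

text \<open>\<open>Ck_on\<close> only asserts that some derivative is C^n; uniqueness identifies it
  with \<open>deriv_within\<close>.\<close>

lemma smooth_on_deriv_within:
  assumes I: "nondegenerate_interval I" and f: "smooth_on I f"
  shows "smooth_on I (deriv_within I f)"
  unfolding smooth_on_def
proof
  fix n
  obtain f' where f': "\<forall>x\<in>I. (f has_derivative f' x) (at x within I)"
    "\<forall>v. Ck_on n I (\<lambda>x. f' x v)" using Ck_on_of_smooth[OF f, of "Suc n"] by auto
  have "deriv_within I f t = f' t 1" if "t \<in> I" for t
  proof (rule deriv_within_eqI[OF I that])
    have "f' t = (\<lambda>v. v *\<^sub>R f' t 1)"
      using linear_real_arg[OF has_derivative_linear[OF f'(1)[rule_format, OF that]]] by blast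
    then show "(f has_vector_derivative f' t 1) (at t within I)"
      using f'(1) that by (metis has_vector_derivative_def)
  qed
  then show "Ck_on n I (deriv_within I f)"
    using f'(2) Ck_on_cong[of I "deriv_within I f" "\<lambda>t. f' t 1"] by blast
qed

section \<open>Antiderivatives and source warps\<close>

text \<open>The interval may be open, half-open or unbounded, so the antiderivative is the signed
  integral from a base point t0. At t the fundamental theorem is applied on a compact [u, v] inside
  I that contains t and t0 and is a neighbourhood of t relative to I.\<close>

lemma interval_antiderivative:
  fixes f :: "real \<Rightarrow> 'a::banach"
  assumes I: "is_interval I" and f: "continuous_on I f"
  shows "\<exists>S. \<forall>t\<in>I. (S has_vector_derivative f t) (at t within I)"
proof (cases "I = {}")
  case False
  then obtain t0 where t0: "t0 \<in> I" by auto
  define S where "S t = (if t0 \<le> t then integral {t0..t} f else - integral {t..t0} f)" for t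
  have sub: "{u..v} \<subseteq> I" if "u \<in> I" "v \<in> I" for u v
    using mem_is_interval_1_I[OF I that] by auto
  have "(S has_vector_derivative f t) (at t within I)" if t: "t \<in> I" for t
  proof -
    \<comment> \<open>u lies strictly to the left of t unless t is the left end of I; v is its
      mirror image. This is what makes [u, v] and I agree near t.\<close>
    obtain u where u: "u \<in> I" "u \<le> t" "u \<le> t0" "u < t \<or> (\<forall>x\<in>I. t \<le> x)"
    proof (cases "\<forall>x\<in>I. t \<le> x")
      case True
      then show ?thesis using that[of t] t t0 by auto
    next
      case False
      then obtain x where "x \<in> I" "x < t" using not_le by blast
      then show ?thesis using that[of "min x t0"] t0 by (auto simp: min_def)
    qed
    obtain v where v: "v \<in> I" "t \<le> v" "t0 \<le> v" "t < v \<or> (\<forall>x\<in>I. x \<le> t)"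
    proof (cases "\<forall>x\<in>I. x \<le> t")
      case True
      then show ?thesis using that[of t] t t0 by auto
    next
      case False
      then obtain x where "x \<in> I" "t < x" using not_le by blast
      then show ?thesis using that[of "max x t0"] t0 by (auto simp: max_def)
    qed
    have cont: "continuous_on {u..v} f" using continuous_on_subset[OF f sub] u v by auto
    then have int: "f integrable_on {x..y}" if "u \<le> x" "y \<le> v" for x y
      by (rule integrable_continuous_real[OF continuous_on_subset]) (use that in auto)
    \<comment> \<open>On [u, v] both branches of \<open>S\<close> become the integral from u minus
      the same constant.\<close>
    have S_eq: "S x = integral {u..x} f - integral {u..t0} f" if "x \<in> {u..v}" for x
    proof (cases "t0 \<le> x")
      case True
      then have "integral {u..t0} f + integral {t0..x} f = integral {u..x} f"
        using that u int by (intro Henstock_Kurzweil_Integration.integral_combine) auto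
      then show ?thesis using True by (simp add: S_def algebra_simps)
    next
      case False
      then have "integral {u..x} f + integral {x..t0} f = integral {u..t0} f"
        using that u v int by (intro Henstock_Kurzweil_Integration.integral_combine) auto
      then show ?thesis using False by (simp add: S_def algebra_simps)
    qed
    have tuv: "t \<in> {u..v}" using u v by auto
    have "((\<lambda>x. integral {u..x} f - integral {u..t0} f) has_vector_derivative f t) (at t within {u..v})"
      using has_vector_derivative_diff[OF integral_has_vector_derivative[OF cont tuv]
          has_vector_derivative_const] by simp
    then have "(S has_vector_derivative f t) (at t within {u..v})"
      by (rule has_vector_derivative_transform[OF tuv, rotated]) (use S_eq in auto)
    moreover have "at t within {u..v} = at t within I"
    proof -
      define A where "A = (if u < t then {u<..} else UNIV) \<inter> (if t < v then {..<v} else UNIV)"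
      have "open A" "t \<in> A" unfolding A_def by auto
      moreover have "x \<in> {u..v}" if "x \<in> I" "x \<in> A" for x
      proof -
        have "u \<le> x" using that u(2,4) by (cases "u < t") (auto simp: A_def)
        moreover have "x \<le> v" using that v(2,4) by (cases "t < v") (auto simp: A_def)
        ultimately show ?thesis by simp
      qed
      then have "{u..v} \<inter> A - {t} = I \<inter> A - {t}" using sub[OF u(1) v(1)] by blast
      ultimately show ?thesis by (intro at_within_nhd[of t A])
    qed
    ultimately show ?thesis by simp
  qed
  then show ?thesis by blast
qed auto

section \<open>The pair of warps determined by F and T\<close>

text \<open>Raising the first warp forces the second one down to keep the product, and both changes
  increase d2/l2^2 - d1/l1^2. Hence two solutions cannot differ in the first warp, and the product
  then fixes the second.\<close>

lemma warp_pair_unique: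
  fixes d1 d2 :: real
  assumes k: "0 < k1" "0 < k2" and d: "0 < d1" "0 < d2"
    and pos: "0 < x1" "0 < x2" "0 < y1" "0 < y2"
    and F: "x1 ^ k1 * x2 ^ k2 = y1 ^ k1 * y2 ^ k2"
    and T: "d2 / x2\<^sup>2 - d1 / x1\<^sup>2 = d2 / y2\<^sup>2 - d1 / y1\<^sup>2"
  shows "x1 = y1 \<and> x2 = y2"
proof -
  have less: False
    if "0 < u1" "0 < u2" "0 < v1" "0 < v2" "u1 < v1" "u1 ^ k1 * u2 ^ k2 = v1 ^ k1 * v2 ^ k2"
      "d2 / u2\<^sup>2 - d1 / u1\<^sup>2 = d2 / v2\<^sup>2 - d1 / v1\<^sup>2" for u1 u2 v1 v2 :: real
  proof -
    have p: "u1 ^ k1 < v1 ^ k1" using that k by (intro power_strict_mono) auto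
    have "v2 < u2"
    proof (rule ccontr)
      assume "\<not> v2 < u2"
      then have "u2 ^ k2 \<le> v2 ^ k2" using that by (intro power_mono) auto
      then have "u1 ^ k1 * u2 ^ k2 < v1 ^ k1 * v2 ^ k2"
        using p that by (intro mult_less_le_imp_less) auto
      then show False using that by simp
    qed
    then have "d2 / u2\<^sup>2 < d2 / v2\<^sup>2"
      using d that by (intro divide_strict_left_mono power_strict_mono) auto
    moreover have "d1 / v1\<^sup>2 < d1 / u1\<^sup>2"
      using d that by (intro divide_strict_left_mono power_strict_mono) auto
    ultimately show False using that by linarith
  qed
  have eq: "x1 = y1"
    using less[OF pos(1,2,3,4) _ F T] less[OF pos(3,4,1,2) _ F[symmetric] T[symmetric]]
    by (cases x1 y1 rule: linorder_cases) auto
  then have "x2 ^ k2 = y2 ^ k2" using F pos by simp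
  then show ?thesis using eq pos k by (metis less_imp_le power_eq_imp_eq_base)
qed

text \<open>
  Substituting \<open>l1 = r e\<^bsup>k\<^sub>2u\<^esup>\<close> and \<open>l2 = r e\<^bsup>-k\<^sub>1u\<^esup>\<close> with \<open>r = F\<^bsup>1/(k\<^sub>1+k\<^sub>2)\<^esup>\<close> solves the product
  equation and turns the second one into \<open>warp_fun u = T r\<^sup>2\<close>.
\<close>

definition warp_fun :: "nat \<Rightarrow> nat \<Rightarrow> real \<Rightarrow> real \<Rightarrow> real \<Rightarrow> real" where
  "warp_fun k1 k2 d1 d2 u = d2 * exp (2 * real k1 * u) - d1 * exp (- (2 * real k2 * u))"

text \<open>The function is a strictly increasing bijection of the real line with positive
  derivative h', and its inverse solves \<open>\<phi>\<close>' = 1 / h'(\<open>\<phi>\<close>), so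
  smoothness follows by bootstrap.\<close>

lemma warp_fun_smooth_inverse:
  assumes k: "0 < k1" "0 < k2" and d: "0 < d1" "0 < d2"
  shows "\<exists>\<phi>. smooth_on UNIV \<phi> \<and> (\<forall>y. warp_fun k1 k2 d1 d2 (\<phi> y) = y)"
proof -
  define h where "h = warp_fun k1 k2 d1 d2"
  define h' where "h' u = d2 * exp (2 * real k1 * u) * (2 * real k1)
    + d1 * exp (- (2 * real k2 * u)) * (2 * real k2)" for u
  have der: "(h has_real_derivative h' u) (at u)" for u
    unfolding h_def h'_def warp_fun_def by (auto intro!: derivative_eq_intros)
  have h'_pos: "0 < h' u" for u
    unfolding h'_def using k d by (intro add_pos_pos mult_pos_pos) auto
  have cont: "isCont h u" for u using der DERIV_isCont by blast
  have mono: "strict_mono h"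
    by (rule strict_monoI) (use der h'_pos DERIV_pos_imp_increasing in blast)
  have surj: "\<exists>u. h u = y" for y
  proof -
    \<comment> \<open>From exp x >= 1 + x: p is chosen to give h p >= d2 + |y|, and q to give h (-q)
      <= -d1 - |y|, which brackets y for the intermediate value theorem.\<close>
    define p where "p = (\<bar>y\<bar> + d1) / (2 * k1 * d2)"
    define q where "q = (\<bar>y\<bar> + d2) / (2 * k2 * d1)"
    have pq: "0 \<le> p" "0 \<le> q" "d2 * (2 * real k1 * p) = \<bar>y\<bar> + d1" "d1 * (2 * real k2 * q) = \<bar>y\<bar> + d2"
      unfolding p_def q_def using k d by (auto simp: field_simps)
    have "d2 * (1 + 2 * real k1 * p) \<le> d2 * exp (2 * real k1 * p)"
      using d by (intro mult_left_mono exp_ge_add_one_self) auto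
    moreover have "d1 * exp (- (2 * real k2 * p)) \<le> d1 * 1"
      using d pq(1) by (intro mult_left_mono) auto
    ultimately have 1: "y \<le> h p"
      unfolding h_def warp_fun_def using pq(3) d abs_ge_self[of y] distrib_left[of d2 1 "2 * real k1 * p"]
      by linarith
    have "d1 * (1 + 2 * real k2 * q) \<le> d1 * exp (2 * real k2 * q)"
      using d by (intro mult_left_mono exp_ge_add_one_self) auto
    moreover have "d2 * exp (- (2 * real k1 * q)) \<le> d2 * 1"
      using d pq(2) by (intro mult_left_mono) auto
    moreover have "h (- q) = d2 * exp (- (2 * real k1 * q)) - d1 * exp (2 * real k2 * q)"
      unfolding h_def warp_fun_def by simp
    ultimately have 2: "h (- q) \<le> y"
      using pq(4) d abs_ge_minus_self[of y] distrib_left[of d1 1 "2 * real k2 * q"] by linarith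
    have "\<exists>x\<ge>- q. x \<le> p \<and> h x = y"
      using 1 2 pq(1,2) cont by (intro IVT' continuous_at_imp_continuous_on) auto
    then show ?thesis by blast
  qed
  define \<phi> where "\<phi> = inv h"
  have h\<phi>: "h (\<phi> y) = y" for y unfolding \<phi>_def using surj by (metis f_inv_into_f rangeI)
  have \<phi>h: "\<phi> (h u) = u" for u unfolding \<phi>_def by (rule inv_f_f[OF strict_mono_imp_inj_on[OF mono]])
  have \<phi>_cont: "isCont \<phi> y" for y
    using isCont_inverse_function2[of "\<phi> y - 1" "\<phi> y" "\<phi> y + 1" \<phi> h] h\<phi> \<phi>h cont by simp
  have \<phi>_der: "(\<phi> has_real_derivative inverse (h' (\<phi> y))) (at y)" for y
    by (rule DERIV_inverse_function[where f = h and a = "y - 1" and b = "y + 1", OF der])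
       (use h'_pos[of "\<phi> y"] h\<phi> \<phi>_cont in auto)
  have h'_smooth: "smooth_on UNIV h'"
  proof -
    have lin: "smooth_on UNIV (\<lambda>u. c * u)" for c :: real
      by (rule smooth_on_real_bootstrap[where f' = "\<lambda>_. c"])
         (auto intro!: derivative_eq_intros Ck_on_const
           simp: has_real_derivative_iff_has_vector_derivative[symmetric])
    have "smooth_on UNIV (\<lambda>u. exp (c * u))" for c :: real
      by (rule smooth_on_comp_real[OF UNIV_I smooth_on_exp lin])
    note e = this[of "2 * real k1"] this[of "- (2 * real k2)"]
    have "smooth_on UNIV (\<lambda>u. d2 * exp (2 * real k1 * u) * (2 * real k1)
        + d1 * exp (- (2 * real k2) * u) * (2 * real k2))"
      by (rule smooth_on_add; rule smooth_on_mult; (rule smooth_on_mult)?; (rule smooth_on_const e))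
    then show ?thesis unfolding h'_def by simp
  qed
  have "smooth_on UNIV \<phi>"
  proof (rule smooth_on_real_bootstrap[where f' = "\<lambda>y. inverse (h' (\<phi> y))"])
    show "(\<phi> has_vector_derivative inverse (h' (\<phi> y))) (at y within UNIV)" for y
      using \<phi>_der has_real_derivative_iff_has_vector_derivative by blast
    fix n assume "Ck_on n UNIV \<phi>"
    then have "Ck_on n UNIV (\<lambda>y. h' (\<phi> y))"
      by (rule Ck_on_comp_real[OF _ Ck_on_of_smooth[OF h'_smooth], rotated]) simp
    then show "Ck_on n UNIV (\<lambda>y. inverse (h' (\<phi> y)))"
      by (rule Ck_on_comp_real[OF _ Ck_on_of_smooth[OF smooth_on_inverse_pos], rotated])
         (use h'_pos in auto)
  qed
  then show ?thesis using h\<phi> unfolding h_def by blast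
qed

lemma warp_pair_smooth_exists:
  fixes F T :: "'a::real_normed_vector \<Rightarrow> real"
  assumes k: "0 < k1" "0 < k2" and d: "0 < d1" "0 < d2"
    and F: "smooth_on S F" "\<And>t. t \<in> S \<Longrightarrow> 0 < F t" and T: "smooth_on S T"
  shows "\<exists>l1 l2. smooth_on S l1 \<and> smooth_on S l2 \<and>
    (\<forall>t\<in>S. 0 < l1 t \<and> 0 < l2 t \<and> l1 t ^ k1 * l2 t ^ k2 = F t \<and>
       d2 / (l2 t)\<^sup>2 - d1 / (l1 t)\<^sup>2 = T t)"
proof -
  obtain \<phi> where \<phi>: "smooth_on UNIV \<phi>" "\<And>y. warp_fun k1 k2 d1 d2 (\<phi> y) = y"
    using warp_fun_smooth_inverse[OF k d] by blast
  \<comment> \<open>Written with \<open>exp\<close> and \<open>ln\<close>, the root of F is smooth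
    by composition.\<close>
  define r where "r t = exp (inverse (real (k1 + k2)) * ln (F t))" for t
  define u where "u t = \<phi> (T t * (r t)\<^sup>2)" for t
  define l1 where "l1 t = r t * exp (real k2 * u t)" for t
  define l2 where "l2 t = r t * exp (- real k1 * u t)" for t
  have lnF: "smooth_on S (\<lambda>t. ln (F t))"
    by (rule smooth_on_comp_real[OF _ smooth_on_ln_pos F(1)]) (use F in auto)
  have r: "smooth_on S r"
    unfolding r_def
    by (rule smooth_on_comp_real[OF UNIV_I smooth_on_exp smooth_on_mult[OF smooth_on_const lnF]])
  have u: "smooth_on S u"
    unfolding u_def
    by (rule smooth_on_comp_real[OF _ \<phi>(1) smooth_on_mult[OF T smooth_on_power[OF r]]]) simp
  have eu: "smooth_on S (\<lambda>t. exp (c * u t))" for c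
    by (rule smooth_on_comp_real[OF UNIV_I smooth_on_exp smooth_on_mult[OF smooth_on_const u]])
  have "smooth_on S l1" "smooth_on S l2"
    unfolding l1_def l2_def by (rule smooth_on_mult[OF r eu])+
  moreover have "0 < l1 t" "0 < l2 t" for t by (simp_all add: l1_def l2_def r_def)
  moreover have "l1 t ^ k1 * l2 t ^ k2 = F t" if "t \<in> S" for t
  proof -
    have "l1 t ^ k1 * l2 t ^ k2
        = r t ^ (k1 + k2) * (exp (real k1 * (real k2 * u t)) * exp (real k2 * (- real k1 * u t)))"
      by (simp only: l1_def l2_def power_mult_distrib power_add exp_of_nat_mult ac_simps)
    also have "\<dots> = exp (real (k1 + k2) * (inverse (real (k1 + k2)) * ln (F t)))"
      unfolding r_def exp_of_nat_mult[symmetric] by (simp add: exp_add[symmetric] algebra_simps)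
    also have "real (k1 + k2) * (inverse (real (k1 + k2)) * ln (F t)) = ln (F t)"
      using k by (simp add: field_simps del: of_nat_add)
    also have "exp (ln (F t)) = F t" using F(2)[OF that] by simp
    finally show ?thesis .
  qed
  moreover have "d2 / (l2 t)\<^sup>2 - d1 / (l1 t)\<^sup>2 = T t" for t
  proof -
    have r0: "0 < r t" by (simp add: r_def)
    have "d2 / (l2 t)\<^sup>2 - d1 / (l1 t)\<^sup>2 = warp_fun k1 k2 d1 d2 (u t) / (r t)\<^sup>2"
      using r0
      by (simp add: l1_def l2_def warp_fun_def power_mult_distrib exp_double[symmetric] exp_minus
          divide_inverse algebra_simps flip: exp_minus)
    then show ?thesis using r0 \<phi>(2) by (simp add: u_def)
  qed
  ultimately show ?thesis by blast
qed

section \<open>Traces of inner products\<close>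

text \<open>
  The condition makes derivatives within \<open>D\<close> unique; it covers chart domains with boundary points.
\<close>

definition approachable :: "'e::euclidean_space set \<Rightarrow> bool" where
  "approachable D \<longleftrightarrow>
     (\<forall>x\<in>D. \<forall>i\<in>Basis. \<forall>e>0. \<exists>d. 0 < \<bar>d\<bar> \<and> \<bar>d\<bar> < e \<and> x + d *\<^sub>R i \<in> D)"

lemma approachable_open:
  fixes D :: "'e::euclidean_space set"
  assumes "open D" shows "approachable D"
  unfolding approachable_def
proof (intro ballI allI impI)
  fix x i :: 'e and e :: real
  assume "x \<in> D" "i \<in> Basis" "0 < e"
  then obtain r where r: "0 < r" "ball x r \<subseteq> D" using assms openE by blast
  have "x + (min r e / 2) *\<^sub>R i \<in> ball x r"
    using \<open>i \<in> Basis\<close> \<open>0 < e\<close> r by (simp add: dist_norm)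
  then show "\<exists>d. 0 < \<bar>d\<bar> \<and> \<bar>d\<bar> < e \<and> x + d *\<^sub>R i \<in> D"
    using r \<open>0 < e\<close> by (intro exI[of _ "min r e / 2"]) auto
qed

lemma approachable_interval:
  assumes "nondegenerate_interval I" shows "approachable I"
  unfolding approachable_def
proof (intro ballI allI impI)
  fix x i e :: real
  assume x: "x \<in> I" "i \<in> Basis" "0 < e"
  then have "x islimpt I"
    using at_within_interval_neq_bot[OF assms x(1)] by (simp add: trivial_limit_within)
  then obtain y where "y \<in> I" "y \<noteq> x" "dist y x < e" using x unfolding islimpt_approachable by blast
  then show "\<exists>d. 0 < \<bar>d\<bar> \<and> \<bar>d\<bar> < e \<and> x + d *\<^sub>R i \<in> I"
    using x by (intro exI[of _ "y - x"]) (auto simp: dist_real_def)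
qed

lemma approachable_Times:
  assumes "approachable A" "approachable B" shows "approachable (A \<times> B)"
  using assms unfolding approachable_def by (fastforce simp: Basis_prod_def)

section \<open>Directional derivatives on approachable domains\<close>

text \<open>\<open>frechet_derivative\<close> chooses among all derivatives, so evaluating it takes
  uniqueness. The criterion used asks for points of D arbitrarily close to x on every coordinate
  line, which is what \<open>approachable\<close> provides.\<close>

lemma dir_deriv_eqI:
  assumes D: "approachable D" "x \<in> D" and f: "(f has_derivative f') (at x within D)"
  shows "dir_deriv D f v x = f' v"
proof -
  have "(f has_derivative frechet_derivative f (at x within D)) (at x within D)"
    using f by (meson differentiableI frechet_derivative_works)
  from frechet_derivative_unique_within[OF this f] show ?thesis
    using D unfolding approachable_def by blast
qed

text \<open>Both sides choose from the same set of derivatives, since a derivative within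
  \<open>D\<close> at a point of \<open>D\<close> sees only values on \<open>D\<close>.\<close>

lemma dir_deriv_cong:
  assumes "\<And>y. y \<in> D \<Longrightarrow> f y = g y" "x \<in> D"
  shows "dir_deriv D f v x = dir_deriv D g v x"
proof -
  have "(f has_derivative f') (at x within D) \<longleftrightarrow> (g has_derivative f') (at x within D)" for f'
    by (rule iffI; erule has_derivative_transform[rotated 2]) (use assms in auto)
  then show ?thesis unfolding frechet_derivative_def by simp
qed

lemma smooth_on_has_derivative:
  assumes "smooth_on D f" "x \<in> D"
  shows "(f has_derivative (\<lambda>v. dir_deriv D f v x)) (at x within D)"
proof -
  have "Ck_on (Suc 0) D f" using assms(1) by (simp add: smooth_on_def)
  then show ?thesis
    using assms(2) unfolding Ck_on.simps by (meson differentiableI frechet_derivative_works)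
qed

lemma smooth_on_dir_deriv:
  assumes D: "approachable D" and f: "smooth_on D f"
  shows "smooth_on D (dir_deriv D f v)"
  unfolding smooth_on_def
proof
  fix n
  obtain f' where f': "\<forall>x\<in>D. (f has_derivative f' x) (at x within D)"
    "\<forall>v. Ck_on n D (\<lambda>x. f' x v)" using Ck_on_of_smooth[OF f, of "Suc n"] by auto
  have "dir_deriv D f v x = f' x v" if "x \<in> D" for x
    by (rule dir_deriv_eqI[OF D that f'(1)[rule_format, OF that]])
  then have "Ck_on n D (dir_deriv D f v) \<longleftrightarrow> Ck_on n D (\<lambda>x. f' x v)" by (rule Ck_on_cong)
  then show "Ck_on n D (dir_deriv D f v)" using f'(2) by blast
qed

section \<open>Inner products, representing vectors and traces\<close>

definition inner_form :: "('e::euclidean_space \<Rightarrow> 'e \<Rightarrow> real) \<Rightarrow> bool" where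
  "inner_form h \<longleftrightarrow> bilinear h \<and> (\<forall>v w. h v w = h w v) \<and> (\<forall>v. v \<noteq> 0 \<longrightarrow> h v v > 0)"

lemma inner_form_eqI:
  assumes h: "inner_form h" and eq: "\<And>w. h u w = h v w"
  shows "u = v"
proof (rule ccontr)
  assume "u \<noteq> v"
  then have "0 < h (u - v) (u - v)" using h by (simp add: inner_form_def)
  also have "h (u - v) (u - v) = 0"
    using h[unfolded inner_form_def, THEN conjunct1, THEN bilinear_lsub] eq by simp
  finally show False by simp
qed

lemma sharp_eqI:
  assumes h: "inner_form h" and v: "\<And>w. h v w = \<alpha> w"
  shows "sharp h \<alpha> = v"
  unfolding sharp_def by (rule the_equality) (use inner_form_eqI[OF h] v in auto)

text \<open>Riesz representation: the Gram map \<open>L\<close> is injective by positive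
  definiteness, hence surjective in finite dimension. This turns the definite description in
  \<open>sharp\<close> into a usable equation.\<close>

lemma sharp_works:
  fixes h :: "'e::euclidean_space \<Rightarrow> 'e \<Rightarrow> real"
  assumes h: "inner_form h" and \<alpha>: "linear \<alpha>"
  shows "h (sharp h \<alpha>) w = \<alpha> w"
proof -
  define L where "L v = (\<Sum>i\<in>Basis. h v i *\<^sub>R i)" for v
  have bil: "bilinear h" using h by (simp add: inner_form_def)
  have expand: "f u = L v \<bullet> u" if "linear f" "\<And>i. i \<in> Basis \<Longrightarrow> f i = h v i"
    for f :: "'e \<Rightarrow> real" and u v
  proof -
    have "f u = f (\<Sum>i\<in>Basis. (u \<bullet> i) *\<^sub>R i)" by (simp add: euclidean_representation)
    also have "\<dots> = (\<Sum>i\<in>Basis. (u \<bullet> i) * h v i)"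
      using that by (simp add: linear_sum linear_scale)
    also have "\<dots> = L v \<bullet> u"
      unfolding L_def inner_sum_left by (intro sum.cong) (auto simp: inner_commute)
    finally show ?thesis .
  qed
  have hL: "h v u = L v \<bullet> u" for v u
    using expand[of "h v" v u] bil by (simp add: bilinear_def)
  have "linear L"
    unfolding L_def using bil
    by (intro linearI) (simp_all add: bilinear_ladd bilinear_lmul scaleR_add_left sum.distrib scaleR_sum_right)
  moreover have "inj L" by (rule injI, rule inner_form_eqI[OF h]) (simp add: hL)
  ultimately have "surj L" by (rule linear_injective_imp_surjective) simp
  then obtain v where v: "L v = (\<Sum>i\<in>Basis. \<alpha> i *\<^sub>R i)" by (metis surjD)
  have "h v i = \<alpha> i" if "i \<in> Basis" for i
    using that by (simp add: hL v inner_sum_left_Basis)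
  then have "h v u = \<alpha> u" for u using expand[OF \<alpha>, of v u] hL by simp
  then show ?thesis using sharp_eqI[OF h, of v \<alpha>] by simp
qed

lemma metric_trace_add:
  "metric_trace h (\<lambda>v w. A v w + B v w) = metric_trace h A + metric_trace h B"
  by (simp add: metric_trace_def scaleR_add_right sum.distrib)

lemma metric_trace_linear_image:
  assumes "linear L" shows "metric_trace h (\<lambda>v w. L (A v w)) = L (metric_trace h A)"
  by (simp add: metric_trace_def linear_sum[OF assms] linear_scale[OF assms])

text \<open>Row i of the inverse metric lists the coordinates of the vector representing the i-th
  coordinate covector, so pairing that row with h evaluates the covector at i and gives 1.\<close>

lemma metric_trace_self:
  fixes h :: "'e::euclidean_space \<Rightarrow> 'e \<Rightarrow> real"
  assumes h: "inner_form h" shows "metric_trace h h = DIM('e)"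
proof -
  have bil: "bilinear h" using h by (simp add: inner_form_def)
  have "(\<Sum>j\<in>Basis. inverse_metric h i j *\<^sub>R h i j) = 1" if i: "i \<in> Basis" for i
  proof -
    define u where "u = sharp h (\<lambda>w. w \<bullet> i)"
    have "(\<Sum>j\<in>Basis. inverse_metric h i j *\<^sub>R h i j) = h i (\<Sum>j\<in>Basis. (u \<bullet> j) *\<^sub>R j)"
      using bil by (simp add: u_def inverse_metric_def bilinear_def linear_sum linear_scale)
    also have "\<dots> = h u i" using h by (simp add: euclidean_representation inner_form_def)
    also have "\<dots> = i \<bullet> i"
      unfolding u_def
      by (rule sharp_works[OF h]) (intro bounded_linear.linear bounded_linear_inner_left)
    finally show ?thesis using i by simp
  qed
  then show ?thesis by (simp add: metric_trace_def)
qed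

text \<open>The fibre blocks of the Hessian of a warped product contain a term g(v, w) u_t; its
  trace produces the dimension factors in the Laplacian.\<close>

lemma metric_trace_self_scaleR:
  fixes h :: "'e::euclidean_space \<Rightarrow> 'e \<Rightarrow> real"
  assumes "inner_form h"
  shows "metric_trace h (\<lambda>v w. (h v w * c) *\<^sub>R y) = (real DIM('e) * c) *\<^sub>R y"
proof -
  have "linear (\<lambda>r. (r * c) *\<^sub>R y)" by (intro linearI) (simp_all add: algebra_simps)
  from metric_trace_linear_image[OF this, of h h] show ?thesis by (simp add: metric_trace_self[OF assms])
qed

lemma sum_Basis_prod:
  fixes f :: "'a::euclidean_space \<times> 'b::euclidean_space \<Rightarrow> 'c::comm_monoid_add"
  shows "sum f Basis = (\<Sum>i\<in>Basis. f (i, 0)) + (\<Sum>j\<in>Basis. f (0, j))"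
proof -
  have "inj_on (\<lambda>u. (u::'a, 0::'b)) Basis" "inj_on (\<lambda>u. (0::'a, u::'b)) Basis"
    by (auto intro!: inj_onI)
  then show ?thesis
    unfolding Basis_prod_def by (subst sum.union_disjoint) (auto simp: sum.reindex)
qed

section \<open>The block-diagonal warped inner product\<close>

text \<open>The warped metric frozen at one point, with \<open>A\<close> and \<open>C\<close> in
  place of the squared warps. This separates the linear algebra of inverse and trace from
  differentiation.\<close>

definition warped_form ::
  "real \<Rightarrow> real \<Rightarrow> ('a::euclidean_space \<Rightarrow> 'a \<Rightarrow> real) \<Rightarrow> ('b::euclidean_space \<Rightarrow> 'b \<Rightarrow> real)
   \<Rightarrow> real \<times> 'a \<times> 'b \<Rightarrow> real \<times> 'a \<times> 'b \<Rightarrow> real" where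
  "warped_form A C g h = (\<lambda>(r, v, w) (r', v', w'). r * r' + A * g v v' + C * h w w')"

lemma inner_form_warped_form:
  assumes "inner_form g" "inner_form h" "0 < A" "0 < C"
  shows "inner_form (warped_form A C g h)"
proof -
  have bil: "bilinear g" "bilinear h" using assms by (auto simp: inner_form_def)
  have nonneg: "0 \<le> g v v" "0 \<le> h w w" for v w
    using assms bil by (metis bilinear_lzero inner_form_def less_eq_real_def)+
  have "bilinear (warped_form A C g h)"
    unfolding bilinear_def warped_form_def
    by (auto intro!: linearI simp: bil[THEN bilinear_ladd] bil[THEN bilinear_radd]
        bil[THEN bilinear_lmul] bil[THEN bilinear_rmul] algebra_simps)
  moreover have "0 < r * r + A * g v v + C * h w w" if "(r, v, w) \<noteq> 0" for r v w
  proof -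
    have "0 \<le> r * r" "0 \<le> A * g v v" "0 \<le> C * h w w" using nonneg assms by auto
    moreover have "0 < r * r \<or> 0 < A * g v v \<or> 0 < C * h w w"
      using that assms by (cases "r = 0"; cases "v = 0") (auto simp: inner_form_def zero_prod_def zero_less_mult_iff)
    ultimately show ?thesis by linarith
  qed
  ultimately show ?thesis
    using assms unfolding inner_form_def by (auto simp: warped_form_def algebra_simps)
qed

lemma linear_inner_left_arg: "linear (\<lambda>w. w \<bullet> i)"
  by (intro bounded_linear.linear bounded_linear_inner_left)

text \<open>A block-diagonal form has a block-diagonal inverse, so the representing vector can be
  written down block by block and verified.\<close>

lemma inverse_metric_warped_form:
  assumes g: "inner_form g" and h: "inner_form h" and A: "0 < A" and C: "0 < C"
  shows "inverse_metric (warped_form A C g h) (q, i, j) (q', i', j') =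
    q * q' + inverse_metric g i i' / A + inverse_metric h j j' / C"
proof -
  have "sharp (warped_form A C g h) (\<lambda>w. w \<bullet> (q, i, j)) =
      (q, (1 / A) *\<^sub>R sharp g (\<lambda>w. w \<bullet> i), (1 / C) *\<^sub>R sharp h (\<lambda>w. w \<bullet> j))"
  proof (rule sharp_eqI[OF inner_form_warped_form[OF assms]])
    show "warped_form A C g h (q, (1 / A) *\<^sub>R sharp g (\<lambda>w. w \<bullet> i), (1 / C) *\<^sub>R sharp h (\<lambda>w. w \<bullet> j)) w
        = w \<bullet> (q, i, j)" for w
      using A C g[unfolded inner_form_def, THEN conjunct1, THEN bilinear_lmul]
        h[unfolded inner_form_def, THEN conjunct1, THEN bilinear_lmul]
      by (cases w) (simp add: warped_form_def
          sharp_works[OF g linear_inner_left_arg] sharp_works[OF h linear_inner_left_arg])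
  qed
  then show ?thesis by (simp add: inverse_metric_def)
qed

lemma inverse_metric_zero_right: "inverse_metric h i 0 = 0"
  by (simp add: inverse_metric_def)

lemma inverse_metric_zero_left:
  assumes "inner_form h" shows "inverse_metric h 0 i = 0"
proof -
  have "sharp h (\<lambda>w. w \<bullet> 0) = 0"
    by (rule sharp_eqI[OF assms])
       (use assms[unfolded inner_form_def, THEN conjunct1, THEN bilinear_lzero] in simp)
  then show ?thesis by (simp add: inverse_metric_def)
qed

text \<open>Mixed entries of the inverse vanish; only the three diagonal blocks of a Hessian or of
  an energy form ever have to be computed.\<close>

lemma metric_trace_warped_form:
  assumes g: "inner_form g" and h: "inner_form h" and A: "0 < A" and C: "0 < C"
  shows "metric_trace (warped_form A C g h) B =
    B (1, 0, 0) (1, 0, 0) + (1 / A) *\<^sub>R metric_trace g (\<lambda>v w. B (0, v, 0) (0, w, 0))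
      + (1 / C) *\<^sub>R metric_trace h (\<lambda>v w. B (0, 0, v) (0, 0, w))"
  unfolding metric_trace_def
  by (simp add: sum_Basis_prod inverse_metric_warped_form[OF assms] inverse_metric_zero_right
      inverse_metric_zero_left[OF g] inverse_metric_zero_left[OF h] zero_prod_def scaleR_sum_right)

section \<open>The Laplacian of a warped product\<close>

text \<open>The covector inside \<open>christoffel\<close>, named so that a candidate for the
  Christoffel vector can be tested against it through \<open>sharp_eqI\<close>.\<close>

definition koszul ::
  "'e::euclidean_space set \<Rightarrow> 'e metric_field \<Rightarrow> 'e \<Rightarrow> 'e \<Rightarrow> 'e \<Rightarrow> 'e \<Rightarrow> real" where
  "koszul D g x v w z = (dir_deriv D (\<lambda>y. g y w z) v x + dir_deriv D (\<lambda>y. g y v z) w x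
     - dir_deriv D (\<lambda>y. g y v w) z x) / 2"

lemma christoffel_koszul: "christoffel D g x v w = sharp (g x) (koszul D g x v w)"
  by (simp add: christoffel_def koszul_def[abs_def])

lemma local_metric_inner_form: "local_metric D g \<Longrightarrow> x \<in> D \<Longrightarrow> inner_form (g x)"
  by (simp add: local_metric_def inner_form_def)

text \<open>Needed for \<open>sharp_works\<close>. Linearity in the last slot passes through the
  derivatives because the metric is bilinear at every point of D.\<close>

lemma koszul_linear:
  assumes D: "approachable D" and g: "local_metric D g" and x: "x \<in> D"
  shows "linear (koszul D g x v w)"
proof -
  have der: "((\<lambda>y. g y v w) has_derivative (\<lambda>z. dir_deriv D (\<lambda>y. g y v w) z x)) (at x within D)"
    for v w using g x by (intro smooth_on_has_derivative) (auto simp: local_metric_def)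
  have bil: "bilinear (g y)" if "y \<in> D" for y using g that by (simp add: local_metric_def)
  have add: "dir_deriv D (\<lambda>y. g y v (z + z')) u x
      = dir_deriv D (\<lambda>y. g y v z) u x + dir_deriv D (\<lambda>y. g y v z') u x" for v z z' u
  proof -
    have "dir_deriv D (\<lambda>y. g y v (z + z')) u x = dir_deriv D (\<lambda>y. g y v z + g y v z') u x"
      by (rule dir_deriv_cong[OF _ x]) (use bil in \<open>simp add: bilinear_radd\<close>)
    also have "\<dots> = dir_deriv D (\<lambda>y. g y v z) u x + dir_deriv D (\<lambda>y. g y v z') u x"
      by (rule dir_deriv_eqI[OF D x has_derivative_add[OF der der]])
    finally show ?thesis .
  qed
  have scale: "dir_deriv D (\<lambda>y. g y v (c *\<^sub>R z)) u x = c * dir_deriv D (\<lambda>y. g y v z) u x"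
    for v z c u
  proof -
    have "dir_deriv D (\<lambda>y. g y v (c *\<^sub>R z)) u x = dir_deriv D (\<lambda>y. c * g y v z) u x"
      by (rule dir_deriv_cong[OF _ x]) (use bil in \<open>simp add: bilinear_rmul\<close>)
    also have "\<dots> = c * dir_deriv D (\<lambda>y. g y v z) u x"
      by (rule dir_deriv_eqI[OF D x has_derivative_mult_right[OF der]])
    finally show ?thesis .
  qed
  have "linear (\<lambda>z. dir_deriv D (\<lambda>y. g y v w) z x)" using der has_derivative_linear by blast
  note lin = linear_add[OF this] linear_scale[OF this]
  show ?thesis
    by (intro linearI) (simp_all add: koszul_def add scale lin algebra_simps diff_divide_distrib add_divide_distrib)
qed

lemma has_derivative_fst_comp:
  assumes "(f has_vector_derivative f') (at t within I)"
  shows "((\<lambda>p. f (fst p)) has_derivative (\<lambda>q. fst q *\<^sub>R f')) (at (t, y) within I \<times> D)"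
proof -
  have "(f has_derivative (\<lambda>r. r *\<^sub>R f')) (at (fst (t, y)) within fst ` (I \<times> D))"
    using assms by (auto simp: has_vector_derivative_def intro: has_derivative_subset)
  from has_derivative_in_compose[OF bounded_linear_imp_has_derivative[OF bounded_linear_fst] this]
  show ?thesis by simp
qed

lemma has_derivative_mid_comp:
  assumes "(f has_derivative f') (at x within D)"
  shows "((\<lambda>p. f (fst (snd p))) has_derivative (\<lambda>q. f' (fst (snd q)))) (at (t, x, y) within I \<times> D \<times> E)"
proof -
  have L: "bounded_linear (\<lambda>p::'c \<times> 'a \<times> 'd. fst (snd p))"
    by (rule bounded_linear_compose[OF bounded_linear_fst bounded_linear_snd])
  have "(f has_derivative f') (at (fst (snd (t, x, y))) within (\<lambda>p. fst (snd p)) ` (I \<times> D \<times> E))"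
    using assms by (auto intro: has_derivative_subset)
  from has_derivative_in_compose[OF bounded_linear_imp_has_derivative[OF L] this]
  show ?thesis by simp
qed

lemma has_derivative_last_comp:
  assumes "(f has_derivative f') (at y within E)"
  shows "((\<lambda>p. f (snd (snd p))) has_derivative (\<lambda>q. f' (snd (snd q)))) (at (t, x, y) within I \<times> D \<times> E)"
proof -
  have L: "bounded_linear (\<lambda>p::'c \<times> 'd \<times> 'a. snd (snd p))"
    by (rule bounded_linear_compose[OF bounded_linear_snd bounded_linear_snd])
  have "(f has_derivative f') (at (snd (snd (t, x, y))) within (\<lambda>p. snd (snd p)) ` (I \<times> D \<times> E))"
    using assms by (auto intro: has_derivative_subset)
  from has_derivative_in_compose[OF bounded_linear_imp_has_derivative[OF L] this]
  show ?thesis by simp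
qed

text \<open>This shape is stable under differentiation along one factor: a t-derivative replaces z1
  and z2 by their derivatives, and a fibre derivative replaces one of f1, f2 by its derivative and
  the other by 0. One formula for first derivatives therefore also yields the second
  derivatives.\<close>

definition product_map ::
  "('z1 \<Rightarrow> 'w1 \<Rightarrow> 'b::real_normed_vector) \<Rightarrow> ('z2 \<Rightarrow> 'w2 \<Rightarrow> 'b) \<Rightarrow> (real \<Rightarrow> 'z1) \<Rightarrow> (real \<Rightarrow> 'z2)
   \<Rightarrow> ('a \<Rightarrow> 'w1) \<Rightarrow> ('c \<Rightarrow> 'w2) \<Rightarrow> real \<times> 'a \<times> 'c \<Rightarrow> 'b" where
  "product_map P Q z1 z2 f1 f2 = (\<lambda>(t, x, y). P (z1 t) (f1 x) + Q (z2 t) (f2 y))"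

lemma product_map_apply: "product_map P Q z1 z2 f1 f2 (t, x, y) = P (z1 t) (f1 x) + Q (z2 t) (f2 y)"
  by (simp add: product_map_def)

section \<open>Connection, Laplacian and energy density of the warped metric\<close>

locale warped_domain =
  fixes I :: "real set" and D1 :: "'e1::euclidean_space set" and D2 :: "'e2::euclidean_space set"
    and g1 :: "'e1 metric_field" and g2 :: "'e2 metric_field" and l1 l2 :: "real \<Rightarrow> real"
  assumes I: "nondegenerate_interval I"
    and D1: "open D1" and D2: "open D2"
    and g1: "local_metric D1 g1" and g2: "local_metric D2 g2"
    and l1: "smooth_on I l1" and l2: "smooth_on I l2"
    and l1_pos: "t \<in> I \<Longrightarrow> 0 < l1 t" and l2_pos: "t \<in> I \<Longrightarrow> 0 < l2 t"
begin

abbreviation "D \<equiv> I \<times> D1 \<times> D2"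

definition wmet :: "(real \<times> 'e1 \<times> 'e2) metric_field" where
  "wmet = (\<lambda>(t, x, y). warped_form ((l1 t)\<^sup>2) ((l2 t)\<^sup>2) (g1 x) (g2 y))"

lemma D_approachable: "approachable D"
  by (intro approachable_Times approachable_interval[OF I] approachable_open D1 D2)

lemma bilinear_g: "x \<in> D1 \<Longrightarrow> bilinear (g1 x)" "y \<in> D2 \<Longrightarrow> bilinear (g2 y)"
  using g1 g2 by (auto simp: local_metric_def)

lemmas g1_form = local_metric_inner_form[OF g1] and g2_form = local_metric_inner_form[OF g2]

lemma wmet_form: "t \<in> I \<Longrightarrow> x \<in> D1 \<Longrightarrow> y \<in> D2 \<Longrightarrow> inner_form (wmet (t, x, y))"
  using l1_pos[of t] l2_pos[of t]
  by (simp add: wmet_def inner_form_warped_form g1_form g2_form)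

lemma wmet_at: "wmet (t, x, y) = warped_form ((l1 t)\<^sup>2) ((l2 t)\<^sup>2) (g1 x) (g2 y)"
  by (simp add: wmet_def)

lemma wmet_apply:
  "wmet (t, x, y) (r, v, w) (r', v', w') = r * r' + (l1 t)\<^sup>2 * g1 x v v' + (l2 t)\<^sup>2 * g2 y w w'"
  by (simp add: wmet_def warped_form_def)

lemma square_has_derivative:
  fixes l :: "real \<Rightarrow> real"
  assumes l: "smooth_on I l" and t: "t \<in> I"
  shows "((\<lambda>t. (l t)\<^sup>2) has_vector_derivative 2 * l t * deriv_within I l t) (at t within I)"
  using smooth_on_has_deriv_within[OF I l t]
  unfolding has_real_derivative_iff_has_vector_derivative[symmetric]
  by (auto intro!: derivative_eq_intros)

text \<open>Paired with the radial field, the metric returns just the t-component of z, a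
  constant.\<close>

lemma dir_deriv_wmet_radial:
  assumes "t \<in> I" "x \<in> D1" "y \<in> D2"
  shows "dir_deriv D (\<lambda>p. wmet p (1, 0, 0) z) q (t, x, y) = 0"
proof -
  have "dir_deriv D (\<lambda>p. wmet p (1, 0, 0) z) q (t, x, y) = dir_deriv D (\<lambda>p. fst z) q (t, x, y)"
    by (rule dir_deriv_cong)
       (use assms in \<open>auto simp: wmet_def warped_form_def bilinear_g bilinear_lzero split: prod.split\<close>)
  also have "\<dots> = 0"
    by (rule dir_deriv_eqI[OF D_approachable _ has_derivative_const]) (use assms in auto)
  finally show ?thesis .
qed

lemma dir_deriv_wmet_first:
  assumes t: "t \<in> I" and x: "x \<in> D1" and y: "y \<in> D2"
  shows "dir_deriv D (\<lambda>p. wmet p (0, w, 0) (r, z1, z2)) (r', v1, v2) (t, x, y) =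
    2 * l1 t * deriv_within I l1 t * r' * g1 x w z1 + (l1 t)\<^sup>2 * dir_deriv D1 (\<lambda>x. g1 x w z1) v1 x"
proof -
  have "dir_deriv D (\<lambda>p. wmet p (0, w, 0) (r, z1, z2)) (r', v1, v2) (t, x, y)
      = dir_deriv D (\<lambda>p. (l1 (fst p))\<^sup>2 * g1 (fst (snd p)) w z1) (r', v1, v2) (t, x, y)"
    by (rule dir_deriv_cong)
       (use assms in \<open>auto simp: wmet_def warped_form_def bilinear_g bilinear_lzero\<close>)
  also have "\<dots> = (l1 t)\<^sup>2 * dir_deriv D1 (\<lambda>x. g1 x w z1) v1 x
      + r' * (2 * l1 t * deriv_within I l1 t) * g1 x w z1"
  proof -
    have "smooth_on D1 (\<lambda>x. g1 x w z1)" using g1 by (simp add: local_metric_def)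
    note d = has_derivative_mult[OF has_derivative_fst_comp[OF square_has_derivative[OF l1 t]]
        has_derivative_mid_comp[OF smooth_on_has_derivative[OF this x]]]
    show ?thesis
      using dir_deriv_eqI[OF D_approachable _ d, of y "(r', v1, v2)"] assms by simp
  qed
  finally show ?thesis by simp
qed

lemma dir_deriv_wmet_second:
  assumes t: "t \<in> I" and x: "x \<in> D1" and y: "y \<in> D2"
  shows "dir_deriv D (\<lambda>p. wmet p (0, 0, w) (r, z1, z2)) (r', v1, v2) (t, x, y) =
    2 * l2 t * deriv_within I l2 t * r' * g2 y w z2 + (l2 t)\<^sup>2 * dir_deriv D2 (\<lambda>y. g2 y w z2) v2 y"
proof -
  have "dir_deriv D (\<lambda>p. wmet p (0, 0, w) (r, z1, z2)) (r', v1, v2) (t, x, y)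
      = dir_deriv D (\<lambda>p. (l2 (fst p))\<^sup>2 * g2 (snd (snd p)) w z2) (r', v1, v2) (t, x, y)"
    by (rule dir_deriv_cong)
       (use assms in \<open>auto simp: wmet_def warped_form_def bilinear_g bilinear_lzero\<close>)
  also have "\<dots> = (l2 t)\<^sup>2 * dir_deriv D2 (\<lambda>y. g2 y w z2) v2 y
      + r' * (2 * l2 t * deriv_within I l2 t) * g2 y w z2"
  proof -
    have "smooth_on D2 (\<lambda>y. g2 y w z2)" using g2 by (simp add: local_metric_def)
    note d = has_derivative_mult[OF has_derivative_fst_comp[OF square_has_derivative[OF l2 t]]
        has_derivative_last_comp[OF smooth_on_has_derivative[OF this y]]]
    show ?thesis
      using dir_deriv_eqI[OF D_approachable _ d, of x "(r', v1, v2)"] assms by simp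
  qed
  finally show ?thesis by simp
qed

text \<open>By \<open>metric_trace_warped_form\<close> only Christoffel symbols of the diagonal
  blocks are needed. This one vanishes because the t-lines are geodesics.\<close>

lemma christoffel_radial:
  assumes "t \<in> I" "x \<in> D1" "y \<in> D2"
  shows "christoffel D wmet (t, x, y) (1, 0, 0) (1, 0, 0) = 0"
  unfolding christoffel_koszul
  by (rule sharp_eqI[OF wmet_form[OF assms]])
     (use wmet_form[OF assms] in
       \<open>simp add: koszul_def dir_deriv_wmet_radial[OF assms] inner_form_def bilinear_lzero\<close>)

text \<open>Testing against the radial direction leaves minus half the t-derivative of l1^2 g1(v,
  w), which is the first component. In the fibre component the factor l1^2 cancels and the
  connection of the factor remains.\<close>

lemma christoffel_first:
  assumes "t \<in> I" "x \<in> D1" "y \<in> D2"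
  shows "christoffel D wmet (t, x, y) (0, v, 0) (0, w, 0) =
    (- (l1 t * deriv_within I l1 t * g1 x v w), christoffel D1 g1 x v w, 0)"
  unfolding christoffel_koszul
proof (rule sharp_eqI[OF wmet_form[OF assms]])
  fix q :: "real \<times> 'e1 \<times> 'e2"
  obtain r z1 z2 where q: "q = (r, z1, z2)" by (cases q)
  have s: "g1 x (sharp (g1 x) (koszul D1 g1 x v w)) z1 = koszul D1 g1 x v w z1"
    by (rule sharp_works[OF g1_form[OF assms(2)] koszul_linear[OF approachable_open[OF D1] g1 assms(2)]])
  show "wmet (t, x, y) (- (l1 t * deriv_within I l1 t * g1 x v w),
      sharp (g1 x) (koszul D1 g1 x v w), 0) q = koszul D wmet (t, x, y) (0, v, 0) (0, w, 0) q"
    using assms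
    by (simp add: q wmet_apply s koszul_def dir_deriv_wmet_first[OF assms] bilinear_g bilinear_lzero
        algebra_simps add_divide_distrib diff_divide_distrib)
qed

lemma christoffel_second:
  assumes "t \<in> I" "x \<in> D1" "y \<in> D2"
  shows "christoffel D wmet (t, x, y) (0, 0, v) (0, 0, w) =
    (- (l2 t * deriv_within I l2 t * g2 y v w), 0, christoffel D2 g2 y v w)"
  unfolding christoffel_koszul
proof (rule sharp_eqI[OF wmet_form[OF assms]])
  fix q :: "real \<times> 'e1 \<times> 'e2"
  obtain r z1 z2 where q: "q = (r, z1, z2)" by (cases q)
  have s: "g2 y (sharp (g2 y) (koszul D2 g2 y v w)) z2 = koszul D2 g2 y v w z2"
    by (rule sharp_works[OF g2_form[OF assms(3)] koszul_linear[OF approachable_open[OF D2] g2 assms(3)]])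
  show "wmet (t, x, y) (- (l2 t * deriv_within I l2 t * g2 y v w),
      0, sharp (g2 y) (koszul D2 g2 y v w)) q = koszul D wmet (t, x, y) (0, 0, v) (0, 0, w) q"
    using assms
    by (simp add: q wmet_apply s koszul_def dir_deriv_wmet_second[OF assms] bilinear_g bilinear_lzero
        algebra_simps add_divide_distrib diff_divide_distrib)
qed

context
  fixes P :: "'z1::real_normed_vector \<Rightarrow> 'w1::real_normed_vector \<Rightarrow> 'b::real_normed_vector"
    and Q :: "'z2::real_normed_vector \<Rightarrow> 'w2::real_normed_vector \<Rightarrow> 'b"
  assumes P: "bounded_bilinear P" and Q: "bounded_bilinear Q"
begin

lemma smooth_on_product_map:
  assumes "smooth_on I z1" "smooth_on I z2" "smooth_on D1 f1" "smooth_on D2 f2"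
  shows "smooth_on D (product_map P Q z1 z2 f1 f2)"
proof -
  have "bounded_linear (\<lambda>p::real \<times> 'e1 \<times> 'e2. fst (snd p))"
    "bounded_linear (\<lambda>p::real \<times> 'e1 \<times> 'e2. snd (snd p))"
    by (rule bounded_linear_compose[OF _ bounded_linear_snd];
        rule bounded_linear_fst bounded_linear_snd)+
  note comp = smooth_on_comp_linear[OF bounded_linear_fst _ assms(1), of D]
    smooth_on_comp_linear[OF bounded_linear_fst _ assms(2), of D]
    smooth_on_comp_linear[OF this(1) _ assms(3), of D]
    smooth_on_comp_linear[OF this(2) _ assms(4), of D]
  have "smooth_on D (\<lambda>p. P (z1 (fst p)) (f1 (fst (snd p))) + Q (z2 (fst p)) (f2 (snd (snd p))))"
    by (rule smooth_on_add[OF smooth_on_bilinear[OF P comp(1,3)] smooth_on_bilinear[OF Q comp(2,4)]])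
       auto
  then show ?thesis by (simp add: product_map_def case_prod_beta')
qed

lemma dir_deriv_product_map:
  assumes z: "smooth_on I z1" "smooth_on I z2" and f: "smooth_on D1 f1" "smooth_on D2 f2"
    and t: "t \<in> I" and x: "x \<in> D1" and y: "y \<in> D2"
  shows "dir_deriv D (product_map P Q z1 z2 f1 f2) (r, v, w) (t, x, y) =
    r *\<^sub>R (P (deriv_within I z1 t) (f1 x) + Q (deriv_within I z2 t) (f2 y))
      + P (z1 t) (dir_deriv D1 f1 v x) + Q (z2 t) (dir_deriv D2 f2 w y)"
proof -
  note dP = bounded_bilinear.FDERIV[OF P has_derivative_fst_comp has_derivative_mid_comp,
      OF smooth_on_has_deriv_within[OF I z(1) t] smooth_on_has_derivative[OF f(1) x], of y]
  note dQ = bounded_bilinear.FDERIV[OF Q has_derivative_fst_comp has_derivative_last_comp,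
      OF smooth_on_has_deriv_within[OF I z(2) t] smooth_on_has_derivative[OF f(2) y], of x]
  have eq: "product_map P Q z1 z2 f1 f2
      = (\<lambda>p. P (z1 (fst p)) (f1 (fst (snd p))) + Q (z2 (fst p)) (f2 (snd (snd p))))"
    by (simp add: product_map_def case_prod_beta')
  show ?thesis
    unfolding eq
    using dir_deriv_eqI[OF D_approachable _ has_derivative_add[OF dP dQ], of "(r, v, w)"] t x y
    by (simp add: bounded_bilinear.scaleR_left[OF P] bounded_bilinear.scaleR_left[OF Q]
        scaleR_add_right)
qed

text \<open>The radial block contributes u_tt. In fibre block i the Hessian of f_i traces to its
  Laplacian over l_i^2, and the radial part of the Christoffel symbol traces to dimension times
  l_i'/l_i times u_t.\<close>

lemma laplacian_product_map:
  assumes z: "smooth_on I z1" "smooth_on I z2" and f: "smooth_on D1 f1" "smooth_on D2 f2"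
    and t: "t \<in> I" and x: "x \<in> D1" and y: "y \<in> D2"
  defines "ut \<equiv> P (deriv_within I z1 t) (f1 x) + Q (deriv_within I z2 t) (f2 y)"
  shows "laplacian D wmet (product_map P Q z1 z2 f1 f2) (t, x, y) =
    P (deriv_within I (deriv_within I z1) t) (f1 x) + Q (deriv_within I (deriv_within I z2) t) (f2 y)
    + (DIM('e1) * deriv_within I l1 t / l1 t + DIM('e2) * deriv_within I l2 t / l2 t) *\<^sub>R ut
    + (1 / (l1 t)\<^sup>2) *\<^sub>R P (z1 t) (laplacian D1 g1 f1 x)
    + (1 / (l2 t)\<^sup>2) *\<^sub>R Q (z2 t) (laplacian D2 g2 f2 y)"
proof -
  let ?u = "product_map P Q z1 z2 f1 f2"
  note zero = bounded_bilinear.zero_left[OF P] bounded_bilinear.zero_left[OF Q]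
    bounded_bilinear.zero_right[OF P] bounded_bilinear.zero_right[OF Q]
  note du = dir_deriv_product_map[OF z f]
  have z': "smooth_on I (deriv_within I z1)" "smooth_on I (deriv_within I z2)"
    using z smooth_on_deriv_within[OF I] by blast+
  have f': "smooth_on D1 (dir_deriv D1 f1 v)" "smooth_on D2 (dir_deriv D2 f2 w)" for v w
    by (intro smooth_on_dir_deriv approachable_open f D1 D2)+
  have p: "(t, x, y) \<in> D" using t x y by simp
  have lin: "dir_deriv D1 f1 0 x = 0" "dir_deriv D2 f2 0 y = 0" if "x \<in> D1" "y \<in> D2" for x y
    using that f smooth_on_has_derivative has_derivative_linear linear_0 by blast+
  have "hessian D wmet ?u (t, x, y) (1, 0, 0) (1, 0, 0)
      = P (deriv_within I (deriv_within I z1) t) (f1 x) + Q (deriv_within I (deriv_within I z2) t) (f2 y)"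
  proof -
    \<comment> \<open>On all of D the first derivative is again a product map, so the
      first-derivative formula applies a second time.\<close>
    have "dir_deriv D (dir_deriv D ?u (1, 0, 0)) (1, 0, 0) (t, x, y)
        = dir_deriv D (product_map P Q (deriv_within I z1) (deriv_within I z2) f1 f2) (1, 0, 0) (t, x, y)"
      by (rule dir_deriv_cong[OF _ p]) (auto simp: du lin zero product_map_apply)
    then show ?thesis
      using t x y
      by (simp add: hessian_def christoffel_radial du dir_deriv_product_map[OF z' f] lin zero zero_prod_def)
  qed
  moreover have "hessian D wmet ?u (t, x, y) (0, v, 0) (0, w, 0)
      = P (z1 t) (hessian D1 g1 f1 x v w) + g1 x v w *\<^sub>R ((l1 t * deriv_within I l1 t) *\<^sub>R ut)" for v w
  proof -
    \<comment> \<open>The zero map in the last slot records that a derivative along the first factor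
      kills the Q term.\<close>
    have "dir_deriv D (dir_deriv D ?u (0, w, 0)) (0, v, 0) (t, x, y)
        = dir_deriv D (product_map P Q z1 z2 (dir_deriv D1 f1 w) (\<lambda>_. 0)) (0, v, 0) (t, x, y)"
      by (rule dir_deriv_cong[OF _ p]) (auto simp: du lin zero product_map_apply)
    also have "\<dots> = P (z1 t) (dir_deriv D1 (dir_deriv D1 f1 w) v x)"
      using dir_deriv_product_map[OF z f'(1) smooth_on_const t x y, of w 0 0 v 0]
      by (simp add: zero dir_deriv_eqI[OF approachable_open[OF D2] y has_derivative_const])
    finally show ?thesis
      using t x y
      by (simp add: hessian_def christoffel_first du lin zero ut_def
          bounded_bilinear.diff_right[OF P] algebra_simps)
  qed
  moreover have "hessian D wmet ?u (t, x, y) (0, 0, v) (0, 0, w)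
      = Q (z2 t) (hessian D2 g2 f2 y v w) + g2 y v w *\<^sub>R ((l2 t * deriv_within I l2 t) *\<^sub>R ut)" for v w
  proof -
    have "dir_deriv D (dir_deriv D ?u (0, 0, w)) (0, 0, v) (t, x, y)
        = dir_deriv D (product_map P Q z1 z2 (\<lambda>_. 0) (dir_deriv D2 f2 w)) (0, 0, v) (t, x, y)"
      by (rule dir_deriv_cong[OF _ p]) (auto simp: du lin zero product_map_apply)
    also have "\<dots> = Q (z2 t) (dir_deriv D2 (dir_deriv D2 f2 w) v y)"
      using dir_deriv_product_map[OF z smooth_on_const f'(2) t x y, of 0 w 0 0 v]
      by (simp add: zero dir_deriv_eqI[OF approachable_open[OF D1] x has_derivative_const])
    finally show ?thesis
      using t x y
      by (simp add: hessian_def christoffel_second du lin zero ut_def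
          bounded_bilinear.diff_right[OF Q] algebra_simps)
  qed
  ultimately show ?thesis
    using l1_pos[OF t] l2_pos[OF t]
      metric_trace_linear_image[of "P (z1 t)" "g1 x" "hessian D1 g1 f1 x"]
      metric_trace_linear_image[of "Q (z2 t)" "g2 y" "hessian D2 g2 f2 y"]
      bounded_linear.linear[OF bounded_bilinear.bounded_linear_right[OF P]]
      bounded_linear.linear[OF bounded_bilinear.bounded_linear_right[OF Q]]
    by (simp add: laplacian_def wmet_at metric_trace_warped_form g1_form g2_form x y
        metric_trace_add metric_trace_self_scaleR scaleR_add_right scaleR_add_left power2_eq_square)
qed

end

text \<open>The inner product conditions say that P and Q take values in orthogonal subspaces and
  that each z acts as a homothety. Hence the cross terms vanish and z enters only through its
  norm.\<close>

lemma energy_density_product_map: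
  fixes P :: "'z1::real_normed_vector \<Rightarrow> 'w1::real_inner \<Rightarrow> 'b::real_inner"
    and Q :: "'z2::real_normed_vector \<Rightarrow> 'w2::real_inner \<Rightarrow> 'b"
  assumes P: "bounded_bilinear P" and Q: "bounded_bilinear Q"
    and P_inner: "\<And>z v w. P z v \<bullet> P z w = (norm z)\<^sup>2 * (v \<bullet> w)"
    and Q_inner: "\<And>z v w. Q z v \<bullet> Q z w = (norm z)\<^sup>2 * (v \<bullet> w)"
    and PQ: "\<And>z v z' w. P z v \<bullet> Q z' w = 0"
    and z: "smooth_on I z1" "smooth_on I z2" and f: "smooth_on D1 f1" "smooth_on D2 f2"
    and t: "t \<in> I" and x: "x \<in> D1" and y: "y \<in> D2"
  shows "energy_density D wmet (product_map P Q z1 z2 f1 f2) (t, x, y) =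
    (norm (deriv_within I z1 t))\<^sup>2 * (norm (f1 x))\<^sup>2 + (norm (deriv_within I z2 t))\<^sup>2 * (norm (f2 y))\<^sup>2
    + (norm (z1 t))\<^sup>2 * energy_density D1 g1 f1 x / (l1 t)\<^sup>2
    + (norm (z2 t))\<^sup>2 * energy_density D2 g2 f2 y / (l2 t)\<^sup>2"
proof -
  note zero = bounded_bilinear.zero_left[OF P] bounded_bilinear.zero_left[OF Q]
    bounded_bilinear.zero_right[OF P] bounded_bilinear.zero_right[OF Q]
  have lin: "dir_deriv D1 f1 0 x = 0" "dir_deriv D2 f2 0 y = 0"
    using x y f smooth_on_has_derivative has_derivative_linear linear_0 by blast+
  have QP: "Q z' w \<bullet> P z v = 0" for z v z' w using PQ by (simp add: inner_commute)
  show ?thesis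
    using l1_pos[OF t] l2_pos[OF t]
      metric_trace_linear_image[of "\<lambda>r. (norm (z1 t))\<^sup>2 * r" "g1 x"]
      metric_trace_linear_image[of "\<lambda>r. (norm (z2 t))\<^sup>2 * r" "g2 y"]
      bounded_linear.linear[OF bounded_linear_mult_right]
    by (simp add: energy_density_def wmet_at metric_trace_warped_form g1_form g2_form x y
        dir_deriv_product_map[OF P Q z f t x y] lin zero inner_add_left inner_add_right P_inner Q_inner
        PQ QP power2_norm_eq_inner)
qed

end

section \<open>Reduction to an ordinary differential equation\<close>

lemma norm_vector_scalar_mult:
  fixes z :: complex and v :: "complex ^ 'n"
  shows "norm (z *s v) = norm z * norm v"
  by (simp add: norm_vec_def norm_mult L2_set_right_distrib)

lemma inner_vector_scalar_mult:
  fixes z :: complex and v w :: "complex ^ 'n"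
  shows "(z *s v) \<bullet> (z *s w) = (norm z)\<^sup>2 * (v \<bullet> w)"
proof -
  have "(z * a) \<bullet> (z * b) = (norm z)\<^sup>2 * (a \<bullet> b)" for a b :: complex
    unfolding cmod_power2 inner_complex_def by (simp add: power2_eq_square algebra_simps)
  then show ?thesis by (simp add: inner_vec_def sum_distrib_left)
qed

text \<open>Padding with 0 writes the pair (z1 f1, z2 f2) as a sum of two bilinear terms, the shape
  required by \<open>product_map\<close>.\<close>

definition fst_mult :: "complex \<Rightarrow> complex ^ 'n \<Rightarrow> (complex ^ 'n) \<times> 'b::zero" where
  "fst_mult z v = (z *s v, 0)"

definition snd_mult :: "complex \<Rightarrow> complex ^ 'n \<Rightarrow> 'b::zero \<times> (complex ^ 'n)" where
  "snd_mult z v = (0, z *s v)"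

lemma bounded_bilinear_fst_mult:
  "bounded_bilinear (fst_mult :: complex \<Rightarrow> complex ^ 'n \<Rightarrow> (complex ^ 'n) \<times> 'b::real_normed_vector)"
proof (rule bounded_bilinear.intro)
  show "\<exists>K. \<forall>a b. norm (fst_mult a b :: (complex ^ 'n) \<times> 'b) \<le> norm a * norm b * K"
    by (intro exI[of _ 1]) (simp add: norm_vector_scalar_mult fst_mult_def norm_Pair)
qed (simp_all add: fst_mult_def vec_eq_iff algebra_simps)

lemma bounded_bilinear_snd_mult:
  "bounded_bilinear (snd_mult :: complex \<Rightarrow> complex ^ 'n \<Rightarrow> 'b::real_normed_vector \<times> (complex ^ 'n))"
proof (rule bounded_bilinear.intro)
  show "\<exists>K. \<forall>a b. norm (snd_mult a b :: 'b \<times> (complex ^ 'n)) \<le> norm a * norm b * K"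
    by (intro exI[of _ 1]) (simp add: norm_vector_scalar_mult snd_mult_def norm_Pair)
qed (simp_all add: snd_mult_def vec_eq_iff algebra_simps)

text \<open>The reduced energy density \<open>|dG|\<^sup>2\<close> of the spiral product with profile \<open>(z1, z2)\<close>.\<close>

definition spiral_energy ::
  "real set \<Rightarrow> real \<Rightarrow> real \<Rightarrow> (real \<Rightarrow> complex) \<Rightarrow> (real \<Rightarrow> complex)
   \<Rightarrow> (real \<Rightarrow> real) \<Rightarrow> (real \<Rightarrow> real) \<Rightarrow> real \<Rightarrow> real" where
  "spiral_energy I d1 d2 z1 z2 l1 l2 t =
     (norm (deriv_within I z1 t))\<^sup>2 + (norm (deriv_within I z2 t))\<^sup>2
     + (norm (z1 t))\<^sup>2 * d1 / (l1 t)\<^sup>2 + (norm (z2 t))\<^sup>2 * d2 / (l2 t)\<^sup>2"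

text \<open>The logarithmic derivative F'/F of the volume factor (see \<open>vol_deriv\<close>),
  which appears as the coefficient of u_t in the Laplacian.\<close>

definition spiral_drift ::
  "real set \<Rightarrow> nat \<Rightarrow> nat \<Rightarrow> (real \<Rightarrow> real) \<Rightarrow> (real \<Rightarrow> real) \<Rightarrow> real \<Rightarrow> real" where
  "spiral_drift I k1 k2 l1 l2 t =
     k1 * deriv_within I l1 t / l1 t + k2 * deriv_within I l2 t / l2 t"

definition spiral_ode ::
  "real set \<Rightarrow> nat \<Rightarrow> nat \<Rightarrow> real \<Rightarrow> real \<Rightarrow> (real \<Rightarrow> complex) \<Rightarrow> (real \<Rightarrow> complex)
   \<Rightarrow> (real \<Rightarrow> real) \<Rightarrow> (real \<Rightarrow> real) \<Rightarrow> real \<Rightarrow> bool" where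
  "spiral_ode I k1 k2 d1 d2 z1 z2 l1 l2 t \<longleftrightarrow>
     deriv_within I (deriv_within I z1) t + spiral_drift I k1 k2 l1 l2 t *\<^sub>R deriv_within I z1 t
       + (spiral_energy I d1 d2 z1 z2 l1 l2 t - d1 / (l1 t)\<^sup>2) *\<^sub>R z1 t = 0 \<and>
     deriv_within I (deriv_within I z2) t + spiral_drift I k1 k2 l1 l2 t *\<^sub>R deriv_within I z2 t
       + (spiral_energy I d1 d2 z1 z2 l1 l2 t - d2 / (l2 t)\<^sup>2) *\<^sub>R z2 t = 0"

text \<open>By the eigenmap equations both components of the Laplacian plus |dG|^2 G are complex
  multiples r1 f1 and r2 f2 of unit vectors. The scalars depend on t alone, so x and y drop out of
  the condition.\<close>

lemma (in warped_domain) spiral_harmonic_at_iff: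
  fixes f1 :: "'e1 \<Rightarrow> complex ^ 'n1" and f2 :: "'e2 \<Rightarrow> complex ^ 'n2"
  assumes z: "smooth_on I z1" "smooth_on I z2" and f: "smooth_on D1 f1" "smooth_on D2 f2"
    and t: "t \<in> I" and x: "x \<in> D1" and y: "y \<in> D2"
    and n: "norm (f1 x) = 1" "norm (f2 y) = 1"
    and e: "energy_density D1 g1 f1 x = d1" "energy_density D2 g2 f2 y = d2"
    and l: "laplacian D1 g1 f1 x = - d1 *\<^sub>R f1 x" "laplacian D2 g2 f2 y = - d2 *\<^sub>R f2 y"
  defines "u \<equiv> \<lambda>(t, x, y). (z1 t *s f1 x, z2 t *s f2 y)"
  shows "laplacian D wmet u (t, x, y) = - energy_density D wmet u (t, x, y) *\<^sub>R u (t, x, y) \<longleftrightarrow>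
    spiral_ode I DIM('e1) DIM('e2) d1 d2 z1 z2 l1 l2 t"
proof -
  have u: "u = product_map fst_mult snd_mult z1 z2 f1 f2"
    by (simp add: u_def product_map_def fst_mult_def snd_mult_def)
  have E: "energy_density D wmet u (t, x, y) = spiral_energy I d1 d2 z1 z2 l1 l2 t"
    unfolding u
    by (subst energy_density_product_map[OF bounded_bilinear_fst_mult bounded_bilinear_snd_mult _ _ _ z f t x y])
       (simp_all add: fst_mult_def snd_mult_def inner_vector_scalar_mult n e spiral_energy_def)
  define r1 where "r1 = deriv_within I (deriv_within I z1) t
    + spiral_drift I DIM('e1) DIM('e2) l1 l2 t *\<^sub>R deriv_within I z1 t
    + (spiral_energy I d1 d2 z1 z2 l1 l2 t - d1 / (l1 t)\<^sup>2) *\<^sub>R z1 t"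
  define r2 where "r2 = deriv_within I (deriv_within I z2) t
    + spiral_drift I DIM('e1) DIM('e2) l1 l2 t *\<^sub>R deriv_within I z2 t
    + (spiral_energy I d1 d2 z1 z2 l1 l2 t - d2 / (l2 t)\<^sup>2) *\<^sub>R z2 t"
  have "laplacian D wmet u (t, x, y) + energy_density D wmet u (t, x, y) *\<^sub>R u (t, x, y)
      = (r1 *s f1 x, r2 *s f2 y)"
    unfolding E unfolding u
      laplacian_product_map[OF bounded_bilinear_fst_mult bounded_bilinear_snd_mult z f t x y] l
    by (simp add: fst_mult_def snd_mult_def product_map_def spiral_drift_def r1_def r2_def
        vec_eq_iff algebra_simps)
  moreover have "laplacian D wmet u (t, x, y) = - energy_density D wmet u (t, x, y) *\<^sub>R u (t, x, y) \<longleftrightarrow>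
      laplacian D wmet u (t, x, y) + energy_density D wmet u (t, x, y) *\<^sub>R u (t, x, y) = 0"
    by (simp add: eq_neg_iff_add_eq_0)
  moreover have "spiral_ode I DIM('e1) DIM('e2) d1 d2 z1 z2 l1 l2 t \<longleftrightarrow> r1 = 0 \<and> r2 = 0"
    by (simp add: spiral_ode_def r1_def r2_def)
  moreover have "f1 x \<noteq> 0" "f2 y \<noteq> 0" using n by auto
  ultimately show ?thesis by (simp add: zero_prod_def)
qed


section \<open>From product charts to a condition on the interval\<close>

lemma riemannian_manifold_chart:
  assumes "riemannian_manifold N" "c \<in> atlas N"
  shows "open (cdom c)" "local_metric (cdom c) (cmet c)" "x \<in> cdom c \<Longrightarrow> cpar c x \<in> topspace (rtop N)"
  using assms unfolding riemannian_manifold_def by blast+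

lemma riemannian_manifold_point:
  assumes "riemannian_manifold N"
  obtains c x where "c \<in> atlas N" "x \<in> cdom c"
  using assms unfolding riemannian_manifold_def by blast

lemma eigenmap_chart:
  fixes f :: "'m \<Rightarrow> 'b::euclidean_space"
  assumes N: "riemannian_manifold N" and f: "eigenmap N d f" and c: "c \<in> atlas N"
  shows "smooth_on (cdom c) (f \<circ> cpar c)"
    and "x \<in> cdom c \<Longrightarrow> norm (f (cpar c x)) = 1"
    and "x \<in> cdom c \<Longrightarrow> energy_density (cdom c) (cmet c) (f \<circ> cpar c) x = d"
    and "x \<in> cdom c \<Longrightarrow> laplacian (cdom c) (cmet c) (f \<circ> cpar c) x = - d *\<^sub>R f (cpar c x)"
proof -
  show "norm (f (cpar c x)) = 1" if "x \<in> cdom c"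
    using f riemannian_manifold_chart(3)[OF N c that]
    by (auto simp: eigenmap_def smooth_sphere_map_def image_subset_iff)
qed (use f c in \<open>auto simp: eigenmap_def smooth_sphere_map_def smooth_map_def\<close>)

lemma smooth_on_polar:
  assumes "smooth_on I a" "smooth_on I s"
  shows "smooth_on I (\<lambda>t. complex_of_real (a t) * cis (s t))"
  by (intro smooth_on_mult smooth_on_bounded_linear[OF bounded_linear_of_real]
      smooth_on_comp_real[OF UNIV_I smooth_on_cis] assms)

text \<open>Smoothness and values in the sphere hold for every such profile, and in each product
  chart the remaining equation is the same one in t. To extract it at a given t, one chart point of
  each manifold suffices; manifolds are nonempty by definition.\<close>

lemma spiral_harmonic_iff:
  fixes N1 :: "('m1, 'e1::euclidean_space) riem" and N2 :: "('m2, 'e2::euclidean_space) riem"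
    and f1 :: "'m1 \<Rightarrow> complex ^ 'n1" and f2 :: "'m2 \<Rightarrow> complex ^ 'n2"
  assumes N: "riemannian_manifold N1" "riemannian_manifold N2"
    and f: "eigenmap N1 d1 f1" "eigenmap N2 d2 f2"
    and I: "nondegenerate_interval I"
    and smooth: "smooth_on I a" "smooth_on I b" "smooth_on I s1" "smooth_on I s2"
      "smooth_on I l1" "smooth_on I l2"
    and circle: "\<And>t. t \<in> I \<Longrightarrow> (a t)\<^sup>2 + (b t)\<^sup>2 = 1"
    and pos: "\<And>t. t \<in> I \<Longrightarrow> 0 < l1 t" "\<And>t. t \<in> I \<Longrightarrow> 0 < l2 t"
  shows "harmonic_sphere_map (warped_source I l1 l2 N1 N2) (spiral_product a b s1 s2 f1 f2) \<longleftrightarrow>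
    (\<forall>t\<in>I. spiral_ode I DIM('e1) DIM('e2) d1 d2
       (\<lambda>t. complex_of_real (a t) * cis (s1 t)) (\<lambda>t. complex_of_real (b t) * cis (s2 t)) l1 l2 t)"
proof -
  define z1 where "z1 = (\<lambda>t. complex_of_real (a t) * cis (s1 t))"
  define z2 where "z2 = (\<lambda>t. complex_of_real (b t) * cis (s2 t))"
  let ?G = "spiral_product a b s1 s2 f1 f2" and ?N = "warped_source I l1 l2 N1 N2"
  have z: "smooth_on I z1" "smooth_on I z2"
    unfolding z1_def z2_def using smooth by (simp_all add: smooth_on_polar)
  have G: "?G = (\<lambda>(t, p, q). (z1 t *s f1 p, z2 t *s f2 q))"
    by (simp add: spiral_product_def profile_curve_def z1_def z2_def)
  have wd: "warped_domain I (cdom c1) (cdom c2) (cmet c1) (cmet c2) l1 l2"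
    if "c1 \<in> atlas N1" "c2 \<in> atlas N2" for c1 c2
    by (rule warped_domain.intro)
       (use I riemannian_manifold_chart[OF N(1) that(1)] riemannian_manifold_chart[OF N(2) that(2)]
         smooth pos in auto)
  have chart: "cdom (warped_chart I l1 l2 c1 c2) = I \<times> cdom c1 \<times> cdom c2"
    "?G \<circ> cpar (warped_chart I l1 l2 c1 c2)
      = (\<lambda>(t, x, y). (z1 t *s (f1 \<circ> cpar c1) x, z2 t *s (f2 \<circ> cpar c2) y))"
    for c1 :: "('m1, 'e1) riem_chart" and c2 :: "('m2, 'e2) riem_chart"
    by (auto simp: warped_chart_def G fun_eq_iff)
  have met: "cmet (warped_chart I l1 l2 c1 c2) = warped_domain.wmet (cmet c1) (cmet c2) l1 l2"
    if "c1 \<in> atlas N1" "c2 \<in> atlas N2" for c1 c2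
    by (auto simp: warped_chart_def warped_domain.wmet_def[OF wd[OF that]] warped_form_def fun_eq_iff)
  have at: "laplacian (cdom c) (cmet c) (?G \<circ> cpar c) (t, x, y)
        = - energy_density (cdom c) (cmet c) (?G \<circ> cpar c) (t, x, y) *\<^sub>R ?G (cpar c (t, x, y))
      \<longleftrightarrow> spiral_ode I DIM('e1) DIM('e2) d1 d2 z1 z2 l1 l2 t"
    if "c = warped_chart I l1 l2 c1 c2" "c1 \<in> atlas N1" "c2 \<in> atlas N2" "t \<in> I" "x \<in> cdom c1" "y \<in> cdom c2"
    for c c1 c2 t x y
  proof -
    note e1 = eigenmap_chart[OF N(1) f(1) that(2)] and e2 = eigenmap_chart[OF N(2) f(2) that(3)]
    have "?G (cpar c (t, x, y)) = (?G \<circ> cpar c) (t, x, y)" by simp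
    then show ?thesis
      unfolding that(1) chart met[OF that(2,3)]
      using warped_domain.spiral_harmonic_at_iff[OF wd[OF that(2,3)] z e1(1) e2(1) that(4,5,6),
          of d1 d2] e1(2-4)[OF that(5)] e2(2-4)[OF that(6)] by simp
  qed
  have "smooth_sphere_map ?N ?G"
    unfolding smooth_sphere_map_def
  proof
    show "smooth_map ?N ?G"
      unfolding smooth_map_def
    proof
      fix c assume "c \<in> atlas ?N"
      then obtain c1 c2 where c: "c = warped_chart I l1 l2 c1 c2" "c1 \<in> atlas N1" "c2 \<in> atlas N2"
        by (auto simp: warped_source_def)
      have "?G \<circ> cpar c = product_map fst_mult snd_mult z1 z2 (f1 \<circ> cpar c1) (f2 \<circ> cpar c2)"
        unfolding c(1) chart by (simp add: product_map_def fst_mult_def snd_mult_def)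
      then show "smooth_on (cdom c) (?G \<circ> cpar c)"
        using warped_domain.smooth_on_product_map[OF wd[OF c(2,3)] bounded_bilinear_fst_mult
            bounded_bilinear_snd_mult z eigenmap_chart(1)[OF N(1) f(1) c(2)]
            eigenmap_chart(1)[OF N(2) f(2) c(3)]]
        by (simp add: c(1) chart(1))
    qed
    have "norm (z1 t *s f1 p, z2 t *s f2 q) = 1"
      if "t \<in> I" "p \<in> topspace (rtop N1)" "q \<in> topspace (rtop N2)" for t p q
    proof -
      have "norm (f1 p) = 1" "norm (f2 q) = 1"
        using f that by (auto simp: eigenmap_def smooth_sphere_map_def image_subset_iff)
      then show ?thesis
        using circle[OF that(1)] by (simp add: norm_Pair norm_vector_scalar_mult z1_def z2_def norm_mult)
    qed
    then show "?G ` topspace (rtop ?N) \<subseteq> sphere 0 1"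
      by (auto simp: G warped_source_def)
  qed
  then have "harmonic_sphere_map ?N ?G \<longleftrightarrow> (\<forall>c\<in>atlas ?N. \<forall>p\<in>cdom c.
      laplacian (cdom c) (cmet c) (?G \<circ> cpar c) p
        = - energy_density (cdom c) (cmet c) (?G \<circ> cpar c) p *\<^sub>R ?G (cpar c p))"
    by (simp add: harmonic_sphere_map_def)
  also have "\<dots> \<longleftrightarrow> (\<forall>t\<in>I. spiral_ode I DIM('e1) DIM('e2) d1 d2 z1 z2 l1 l2 t)"
  proof (intro iffI ballI)
    fix t
    assume *: "\<forall>c\<in>atlas ?N. \<forall>p\<in>cdom c. laplacian (cdom c) (cmet c) (?G \<circ> cpar c) p
        = - energy_density (cdom c) (cmet c) (?G \<circ> cpar c) p *\<^sub>R ?G (cpar c p)" and t: "t \<in> I"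
    obtain c1 x where c1: "c1 \<in> atlas N1" "x \<in> cdom c1" using riemannian_manifold_point[OF N(1)] .
    obtain c2 y where c2: "c2 \<in> atlas N2" "y \<in> cdom c2" using riemannian_manifold_point[OF N(2)] .
    have "warped_chart I l1 l2 c1 c2 \<in> atlas ?N" using c1 c2 by (auto simp: warped_source_def)
    moreover have "(t, x, y) \<in> cdom (warped_chart I l1 l2 c1 c2)"
      using t c1 c2 by (simp add: chart(1))
    ultimately show "spiral_ode I DIM('e1) DIM('e2) d1 d2 z1 z2 l1 l2 t"
      using at[OF refl c1(1) c2(1) t c1(2) c2(2)] * by blast
  next
    fix c p
    assume *: "\<forall>t\<in>I. spiral_ode I DIM('e1) DIM('e2) d1 d2 z1 z2 l1 l2 t"
      and "c \<in> atlas ?N" and p: "p \<in> cdom c"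
    then obtain c1 c2 where c: "c = warped_chart I l1 l2 c1 c2" "c1 \<in> atlas N1" "c2 \<in> atlas N2"
      by (auto simp: warped_source_def)
    obtain t x y where txy: "p = (t, x, y)" by (cases p)
    then have "t \<in> I" "x \<in> cdom c1" "y \<in> cdom c2" using p by (auto simp: c(1) chart(1))
    then show "laplacian (cdom c) (cmet c) (?G \<circ> cpar c) p
        = - energy_density (cdom c) (cmet c) (?G \<circ> cpar c) p *\<^sub>R ?G (cpar c p)"
      unfolding txy using at[OF c] * by blast
  qed
  finally show ?thesis unfolding z1_def z2_def .
qed

section \<open>The equation in polar form\<close>

lemma smooth_on_DERIV:
  fixes f :: "real \<Rightarrow> real"
  assumes "nondegenerate_interval I" "smooth_on I f" "t \<in> I"
  shows "(f has_real_derivative deriv_within I f t) (at t within I)"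
  using smooth_on_has_deriv_within[OF assms] by (simp add: has_real_derivative_iff_has_vector_derivative)

text \<open>The form in which identities that hold on I are differentiated below.\<close>

lemma interval_DERIV_unique:
  fixes f g :: "real \<Rightarrow> real"
  assumes I: "nondegenerate_interval I" "t \<in> I"
    and f: "(f has_real_derivative x) (at t within I)" and g: "(g has_real_derivative y) (at t within I)"
    and eq: "\<And>t. t \<in> I \<Longrightarrow> f t = g t"
  shows "x = y"
proof -
  have "(g has_real_derivative x) (at t within I)"
    using f unfolding has_field_derivative_def
    by (rule has_derivative_transform[OF I(2), rotated]) (simp add: eq)
  then show ?thesis
    using g deriv_within_eqI[OF I, of g x] deriv_within_eqI[OF I, of g y]
    by (simp add: has_real_derivative_iff_has_vector_derivative)
qed

lemma interval_DERIV_zero_const: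
  fixes f :: "real \<Rightarrow> real"
  assumes I: "nondegenerate_interval I"
    and f: "\<And>t. t \<in> I \<Longrightarrow> (f has_real_derivative 0) (at t within I)"
  shows "\<exists>C. \<forall>t\<in>I. f t = C"
proof -
  have "convex I" using I is_interval_convex[of I] by (simp add: nondegenerate_interval_def)
  then show ?thesis
    by (rule has_derivative_zero_constant) (use f in \<open>simp add: has_field_derivative_def lambda_zero\<close>)
qed

section \<open>Polar coordinates for the profile curve\<close>

text \<open>The phase factor survives differentiation while the coefficient w turns into w' + i s'
  w. Two applications give the first and second polar derivatives with \<open>cis\<close> still
  factored out.\<close>

lemma cis_mult_has_vector_derivative:
  assumes w: "(w has_vector_derivative w') (at t within I)"
    and s: "(s has_real_derivative s') (at t within I)"
  shows "((\<lambda>t. w t * cis (s t)) has_vector_derivative (w' + \<i> * of_real s' * w t) * cis (s t))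
    (at t within I)"
proof -
  have "((\<lambda>t. cis (s t)) has_vector_derivative s' *\<^sub>R (\<i> * cis (s t))) (at t within I)"
  proof -
    have "(s has_derivative (*) s') (at t within I)" using s by (simp add: has_field_derivative_def)
    moreover have "(\<lambda>h. (s' * h) *\<^sub>R (\<i> * cis (s t))) = (\<lambda>h. h *\<^sub>R (s' *\<^sub>R (\<i> * cis (s t))))"
      by (simp add: fun_eq_iff mult.commute)
    ultimately show ?thesis
      unfolding has_vector_derivative_def by (metis has_derivative_cis)
  qed
  from has_vector_derivative_mult[OF w this] show ?thesis
    by (simp add: scaleR_conv_of_real algebra_simps)
qed

lemma polar_deriv_within:
  assumes I: "nondegenerate_interval I" and a: "smooth_on I a" and s: "smooth_on I s" and t: "t \<in> I"
  shows "deriv_within I (\<lambda>t. complex_of_real (a t) * cis (s t)) t =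
    Complex (deriv_within I a t) (a t * deriv_within I s t) * cis (s t)"
proof (rule deriv_within_eqI[OF I t])
  have "((\<lambda>t. complex_of_real (a t)) has_vector_derivative of_real (deriv_within I a t)) (at t within I)"
    using has_vector_derivative_of_real smooth_on_DERIV[OF I a t] by blast
  from cis_mult_has_vector_derivative[OF this smooth_on_DERIV[OF I s t]]
  show "((\<lambda>t. complex_of_real (a t) * cis (s t)) has_vector_derivative
      Complex (deriv_within I a t) (a t * deriv_within I s t) * cis (s t)) (at t within I)"
    by (simp add: Complex_eq ac_simps)
qed

lemma polar_deriv_within2:
  assumes I: "nondegenerate_interval I" and a: "smooth_on I a" and s: "smooth_on I s" and t: "t \<in> I"
  defines "a' \<equiv> deriv_within I a" and "s' \<equiv> deriv_within I s"
  shows "deriv_within I (deriv_within I (\<lambda>t. complex_of_real (a t) * cis (s t))) t =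
    Complex (deriv_within I a' t - a t * (s' t)\<^sup>2) (2 * a' t * s' t + a t * deriv_within I s' t) * cis (s t)"
proof (rule deriv_within_eqI[OF I t])
  have smooth: "smooth_on I a'" "smooth_on I s'"
    unfolding a'_def s'_def using a s smooth_on_deriv_within[OF I] by blast+
  have "((\<lambda>t. a t * s' t) has_real_derivative a' t * s' t + deriv_within I s' t * a t) (at t within I)"
    using DERIV_mult[OF smooth_on_DERIV[OF I a t] smooth_on_DERIV[OF I smooth(2) t]] by (simp add: a'_def)
  then have "((\<lambda>t. Complex (a' t) (a t * s' t)) has_vector_derivative
      Complex (deriv_within I a' t) (a' t * s' t + deriv_within I s' t * a t)) (at t within I)"
    using smooth_on_DERIV[OF I smooth(1) t]
    by (simp add: has_vector_derivative_complex_iff)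
  from cis_mult_has_vector_derivative[OF this smooth_on_DERIV[OF I s t]]
  have "((\<lambda>t. Complex (a' t) (a t * s' t) * cis (s t)) has_vector_derivative
      Complex (deriv_within I a' t - a t * (s' t)\<^sup>2) (2 * a' t * s' t + a t * deriv_within I s' t) * cis (s t))
      (at t within I)"
    by (rule back_subst[of "\<lambda>d. (_ has_vector_derivative d) _"])
       (simp add: complex_eq_iff s'_def power2_eq_square algebra_simps)
  then show "(deriv_within I (\<lambda>t. complex_of_real (a t) * cis (s t)) has_vector_derivative
      Complex (deriv_within I a' t - a t * (s' t)\<^sup>2) (2 * a' t * s' t + a t * deriv_within I s' t) * cis (s t))
      (at t within I)"
    by (rule has_vector_derivative_transform[OF t, rotated])
       (simp add: polar_deriv_within[OF I a s] a'_def s'_def)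
qed

text \<open>Every term carries the nonzero factor \<open>cis (s t)\<close>; the complex coefficient
  that is left splits into a radial and an angular equation.\<close>

lemma polar_ode_iff:
  assumes I: "nondegenerate_interval I" and a: "smooth_on I a" and s: "smooth_on I s" and t: "t \<in> I"
  defines "a' \<equiv> deriv_within I a" and "s' \<equiv> deriv_within I s"
    and "z \<equiv> \<lambda>t. complex_of_real (a t) * cis (s t)"
  shows "deriv_within I (deriv_within I z) t + \<mu> *\<^sub>R deriv_within I z t + \<kappa> *\<^sub>R z t = 0 \<longleftrightarrow>
    deriv_within I a' t - a t * (s' t)\<^sup>2 + \<mu> * a' t + \<kappa> * a t = 0 \<and>
    2 * a' t * s' t + a t * deriv_within I s' t + \<mu> * a t * s' t = 0"
proof -
  have "deriv_within I (deriv_within I z) t + \<mu> *\<^sub>R deriv_within I z t + \<kappa> *\<^sub>R z t =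
    Complex (deriv_within I a' t - a t * (s' t)\<^sup>2 + \<mu> * a' t + \<kappa> * a t)
      (2 * a' t * s' t + a t * deriv_within I s' t + \<mu> * a t * s' t) * cis (s t)"
    unfolding z_def polar_deriv_within[OF I a s t] polar_deriv_within2[OF I a s t]
    by (simp add: a'_def s'_def complex_eq_iff algebra_simps)
  then show ?thesis by (simp add: Complex_eq_0)
qed

lemma norm_polar_deriv_within:
  assumes "nondegenerate_interval I" "smooth_on I a" "smooth_on I s" "t \<in> I"
  shows "(norm (deriv_within I (\<lambda>t. complex_of_real (a t) * cis (s t)) t))\<^sup>2 =
    (deriv_within I a t)\<^sup>2 + (a t)\<^sup>2 * (deriv_within I s t)\<^sup>2"
  by (simp add: polar_deriv_within[OF assms] norm_mult complex_norm power_mult_distrib)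

lemma unit_speed_iff:
  assumes I: "nondegenerate_interval I"
    and s: "smooth_on I a" "smooth_on I b" "smooth_on I s1" "smooth_on I s2"
  shows "unit_speed I a b s1 s2 \<longleftrightarrow> (\<forall>t\<in>I.
    (deriv_within I a t)\<^sup>2 + (a t)\<^sup>2 * (deriv_within I s1 t)\<^sup>2
    + ((deriv_within I b t)\<^sup>2 + (b t)\<^sup>2 * (deriv_within I s2 t)\<^sup>2) = 1)"
  unfolding unit_speed_def
proof (rule ball_cong[OF refl])
  fix t assume t: "t \<in> I"
  define z1 where "z1 = (\<lambda>t. complex_of_real (a t) * cis (s1 t))"
  define z2 where "z2 = (\<lambda>t. complex_of_real (b t) * cis (s2 t))"
  have "smooth_on I z1" "smooth_on I z2"
    unfolding z1_def z2_def using s by (simp_all add: smooth_on_polar)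
  then have "(profile_curve a b s1 s2 has_vector_derivative (deriv_within I z1 t, deriv_within I z2 t))
      (at t within I)"
    using smooth_on_has_deriv_within[OF I _ t]
    unfolding profile_curve_def[abs_def] z1_def[symmetric, THEN fun_cong] z2_def[symmetric, THEN fun_cong]
    by (intro has_vector_derivative_Pair) auto
  then have "deriv_within I (profile_curve a b s1 s2) t = (deriv_within I z1 t, deriv_within I z2 t)"
    by (rule deriv_within_eqI[OF I t])
  then show "norm (deriv_within I (profile_curve a b s1 s2) t) = 1 \<longleftrightarrow>
    (deriv_within I a t)\<^sup>2 + (a t)\<^sup>2 * (deriv_within I s1 t)\<^sup>2
    + ((deriv_within I b t)\<^sup>2 + (b t)\<^sup>2 * (deriv_within I s2 t)\<^sup>2) = 1"
    using norm_polar_deriv_within[OF I s(1,3) t] norm_polar_deriv_within[OF I s(2,4) t]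
    by (simp add: norm_Pair z1_def z2_def)
qed

text \<open>
  The two real parts combined with weights \<open>a\<^sup>2\<close>, \<open>b\<^sup>2\<close> hold identically because the profile lies on a
  circle; only their difference carries information.
\<close>

lemma real_parts_iff_difference:
  fixes a b :: real
  assumes ab: "0 < a" "0 < b" "a\<^sup>2 + b\<^sup>2 = 1" and c1: "a * a1 + b * b1 = 0"
    and c2: "a1\<^sup>2 + a * a2 + b1\<^sup>2 + b * b2 = 0"
    and E: "E = a1\<^sup>2 + a\<^sup>2 * s\<^sup>2 + (b1\<^sup>2 + b\<^sup>2 * w\<^sup>2) + a\<^sup>2 * e1 + b\<^sup>2 * e2"
  shows "a2 - a * s\<^sup>2 + \<mu> * a1 + (E - e1) * a = 0 \<and> b2 - b * w\<^sup>2 + \<mu> * b1 + (E - e2) * b = 0 \<longleftrightarrow>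
    e2 - e1 = b2 / b - a2 / a - w\<^sup>2 + s\<^sup>2 + \<mu> * (b1 / b - a1 / a)"
proof -
  \<comment> \<open>p and q are the two equations divided by a and b, with the common E left out.
    The circle relations give E = -(a^2 p + b^2 q), which makes both residuals multiples of p -
    q.\<close>
  define p where "p = a2 / a - s\<^sup>2 + \<mu> * a1 / a - e1"
  define q where "q = b2 / b - w\<^sup>2 + \<mu> * b1 / b - e2"
  have ap: "a2 - a * s\<^sup>2 + \<mu> * a1 + (E - e1) * a = a * (p + E)"
    and bq: "b2 - b * w\<^sup>2 + \<mu> * b1 + (E - e2) * b = b * (q + E)"
    using ab by (simp_all add: p_def q_def field_simps)
  have "a\<^sup>2 * p + b\<^sup>2 * q = a * a2 + b * b2 - a\<^sup>2 * s\<^sup>2 - b\<^sup>2 * w\<^sup>2 + \<mu> * (a * a1 + b * b1) - a\<^sup>2 * e1 - b\<^sup>2 * e2"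
    using ab by (simp add: p_def q_def field_simps power2_eq_square)
  then have "E = - (a\<^sup>2 * p + b\<^sup>2 * q)" using c1 c2 E by simp
  then have "p + E = (1 - a\<^sup>2) * p - b\<^sup>2 * q" "q + E = (1 - b\<^sup>2) * q - a\<^sup>2 * p"
    by (simp_all add: algebra_simps)
  moreover have "1 - a\<^sup>2 = b\<^sup>2" "1 - b\<^sup>2 = a\<^sup>2" using ab by linarith+
  ultimately have "p + E = b\<^sup>2 * (p - q)" "q + E = a\<^sup>2 * (q - p)" by (simp_all add: algebra_simps)
  moreover have "p = q \<longleftrightarrow> e2 - e1 = b2 / b - a2 / a - w\<^sup>2 + s\<^sup>2 + \<mu> * (b1 / b - a1 / a)"
    by (auto simp: p_def q_def algebra_simps)
  ultimately show ?thesis unfolding ap bq using ab by auto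
qed

text \<open>After multiplication by F^2 a^2 b^2 the angular energies become squared momenta and add
  up to eps b^2 + c^2 eps a^2 = eps Q, which is the origin of Q. The radial energies combine to F^2
  a^2 a1^2 because b b1 = -a a1.\<close>

lemma speed_iff_radial:
  fixes a b F :: real
  assumes ab: "0 < a" "0 < b" "a\<^sup>2 + b\<^sup>2 = 1" and F: "0 < F" and c1: "a * a1 + b * b1 = 0"
    and s: "(F * a\<^sup>2 * s)\<^sup>2 = \<epsilon>" and w: "(F * b\<^sup>2 * w)\<^sup>2 = c\<^sup>2 * \<epsilon>"
  shows "a1\<^sup>2 + a\<^sup>2 * s\<^sup>2 + (b1\<^sup>2 + b\<^sup>2 * w\<^sup>2) = 1 \<longleftrightarrow>
    F\<^sup>2 * a\<^sup>2 * (1 - a\<^sup>2 - a1\<^sup>2) = \<epsilon> * (1 + (c\<^sup>2 - 1) * a\<^sup>2)"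
proof -
  have b2: "b\<^sup>2 = 1 - a\<^sup>2" using ab by linarith
  have b1: "b\<^sup>2 * b1\<^sup>2 = a\<^sup>2 * a1\<^sup>2"
  proof -
    have "b * b1 = - (a * a1)" using c1 by linarith
    then have "(b * b1)\<^sup>2 = (a * a1)\<^sup>2" by simp
    then show ?thesis by (simp add: power_mult_distrib)
  qed
  have "F\<^sup>2 * a\<^sup>2 * b\<^sup>2 * (a1\<^sup>2 + a\<^sup>2 * s\<^sup>2 + (b1\<^sup>2 + b\<^sup>2 * w\<^sup>2))
      = F\<^sup>2 * a\<^sup>2 * (b\<^sup>2 * a1\<^sup>2 + b\<^sup>2 * b1\<^sup>2) + b\<^sup>2 * (F * a\<^sup>2 * s)\<^sup>2 + a\<^sup>2 * (F * b\<^sup>2 * w)\<^sup>2"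
    by (simp add: power_mult_distrib algebra_simps)
  also have "\<dots> = F\<^sup>2 * a\<^sup>2 * a1\<^sup>2 + \<epsilon> * (1 + (c\<^sup>2 - 1) * a\<^sup>2)"
    unfolding b1 s w unfolding b2 by (simp add: algebra_simps)
  finally have *: "F\<^sup>2 * a\<^sup>2 * b\<^sup>2 * (a1\<^sup>2 + a\<^sup>2 * s\<^sup>2 + (b1\<^sup>2 + b\<^sup>2 * w\<^sup>2))
      = F\<^sup>2 * a\<^sup>2 * a1\<^sup>2 + \<epsilon> * (1 + (c\<^sup>2 - 1) * a\<^sup>2)" .
  have "F\<^sup>2 * a\<^sup>2 * b\<^sup>2 \<noteq> 0" using ab F by simp
  then have "a1\<^sup>2 + a\<^sup>2 * s\<^sup>2 + (b1\<^sup>2 + b\<^sup>2 * w\<^sup>2) = 1 \<longleftrightarrow>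
      F\<^sup>2 * a\<^sup>2 * b\<^sup>2 * (a1\<^sup>2 + a\<^sup>2 * s\<^sup>2 + (b1\<^sup>2 + b\<^sup>2 * w\<^sup>2)) = F\<^sup>2 * a\<^sup>2 * b\<^sup>2 * 1"
    by (subst mult_cancel_left) simp
  also have "\<dots> \<longleftrightarrow> F\<^sup>2 * a\<^sup>2 * (1 - a\<^sup>2 - a1\<^sup>2) = \<epsilon> * (1 + (c\<^sup>2 - 1) * a\<^sup>2)"
    unfolding * unfolding b2 by (simp add: algebra_simps) argo
  finally show ?thesis .
qed

text \<open>Everything is expressed through a, a2, R, Q, c and B = b^2. The relation
  \<open>rad\<close> removes F and eps, and \<open>drift\<close>, which is \<open>rad\<close>
  differentiated, gives \<open>\<mu>\<close> as a multiple of a1.\<close>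

lemma difference_radial:
  fixes a b F :: real
  assumes ab: "0 < a" "0 < b" "a\<^sup>2 + b\<^sup>2 = 1" and F: "0 < F" and \<epsilon>: "0 < \<epsilon>"
    and c1: "a * a1 + b * b1 = 0" and c2: "a1\<^sup>2 + a * a2 + b1\<^sup>2 + b * b2 = 0"
    and s: "(F * a\<^sup>2 * s)\<^sup>2 = \<epsilon>" and w: "(F * b\<^sup>2 * w)\<^sup>2 = c\<^sup>2 * \<epsilon>"
    and R: "R = 1 - a\<^sup>2 - a1\<^sup>2" "0 < R" and Q: "Q = 1 + (c\<^sup>2 - 1) * a\<^sup>2" "0 < Q"
    and rad: "F\<^sup>2 * a\<^sup>2 * R = \<epsilon> * Q"
    and drift: "2 * \<mu> * F\<^sup>2 * a\<^sup>2 * R + F\<^sup>2 * (2 * a * a1 * R - 2 * a\<^sup>2 * a1 * (a + a2))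
      = \<epsilon> * ((c\<^sup>2 - 1) * (2 * a * a1))"
  shows "b2 / b - a2 / a - w\<^sup>2 + s\<^sup>2 + \<mu> * (b1 / b - a1 / a) = 1 / (a\<^sup>2 * Q) - (a + a2) / (a * R)"
proof -
  define B where "B = 1 - a\<^sup>2"
  have b2: "b\<^sup>2 = B" using ab(3) unfolding B_def by linarith
  have B: "0 < B" using zero_less_power[OF ab(2), of 2] by (simp add: b2)
  have aa1: "a1\<^sup>2 = B - R" using R by (simp add: B_def)
  \<comment> \<open>Replacing eps in \<open>rad\<close> by the squared momentum cancels F and leaves
    the phase speed; w is treated in the same way.\<close>
  have s2: "s\<^sup>2 = R / (a\<^sup>2 * Q)"
  proof -
    have "F\<^sup>2 * a\<^sup>2 * R = F\<^sup>2 * a\<^sup>2 * (a\<^sup>2 * s\<^sup>2 * Q)"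
      unfolding rad s[symmetric] by (simp add: power2_eq_square)
    then have "R = a\<^sup>2 * s\<^sup>2 * Q" using F ab by simp
    then show ?thesis using ab Q(2) by (simp add: field_simps)
  qed
  have w2: "w\<^sup>2 = c\<^sup>2 * a\<^sup>2 * R / (B\<^sup>2 * Q)"
  proof -
    have "F\<^sup>2 * (c\<^sup>2 * a\<^sup>2 * R) = c\<^sup>2 * \<epsilon> * Q" using rad by simp
    also have "\<dots> = F\<^sup>2 * (B\<^sup>2 * w\<^sup>2 * Q)" unfolding w[symmetric] b2 by (simp add: power2_eq_square)
    finally have "c\<^sup>2 * a\<^sup>2 * R = B\<^sup>2 * w\<^sup>2 * Q" using F by simp
    then show ?thesis using B Q(2) by (simp add: field_simps)
  qed
  have b1: "b1 / b = - (a * a1) / B"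
  proof -
    have "b * b1 = - (a * a1)" using c1 by linarith
    then show ?thesis using ab(2) by (simp add: b2[symmetric] power2_eq_square field_simps)
  qed
  have b1b1: "b1\<^sup>2 = a\<^sup>2 * (B - R) / B"
  proof -
    have "b * b1 = - (a * a1)" using c1 by linarith
    then have "(b * b1)\<^sup>2 = (a * a1)\<^sup>2" by simp
    then have "B * b1\<^sup>2 = a\<^sup>2 * (B - R)" by (simp add: power_mult_distrib b2 aa1)
    then show ?thesis using B by (simp add: field_simps)
  qed
  have b2b: "b2 / b = - ((B - R) + a * a2 + a\<^sup>2 * (B - R) / B) / B"
  proof -
    have "b * b2 = - (a1\<^sup>2 + a * a2 + b1\<^sup>2)" using c2 by linarith
    then have "b * b2 = - ((B - R) + a * a2 + a\<^sup>2 * (B - R) / B)" by (simp add: aa1 b1b1)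
    moreover have "b2 / b = (b * b2) / B" using ab(2) by (simp add: b2[symmetric] power2_eq_square)
    ultimately show ?thesis by simp
  qed
  have \<mu>: "\<mu> * (a * R * Q) = (a\<^sup>2 * R * (c\<^sup>2 - 1) - Q * (R - a * (a + a2))) * a1"
  proof -
    have "(2 * F\<^sup>2 * a) * (\<mu> * (a * R * Q))
        = Q * (\<epsilon> * ((c\<^sup>2 - 1) * (2 * a * a1)) - F\<^sup>2 * (2 * a * a1 * R - 2 * a\<^sup>2 * a1 * (a + a2)))"
      unfolding drift[symmetric] by (simp add: power2_eq_square algebra_simps)
    also have "\<dots> = (\<epsilon> * Q) * ((c\<^sup>2 - 1) * (2 * a * a1)) - Q * (F\<^sup>2 * (2 * a * a1 * R - 2 * a\<^sup>2 * a1 * (a + a2)))"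
      by (simp add: algebra_simps)
    also have "\<dots> = (2 * F\<^sup>2 * a) * ((a\<^sup>2 * R * (c\<^sup>2 - 1) - Q * (R - a * (a + a2))) * a1)"
      unfolding rad[symmetric] by (simp add: power2_eq_square algebra_simps)
    finally show ?thesis using F ab by simp
  qed
  \<comment> \<open>Since b1/b - a1/a = -a1/(a B), only this product is needed, and a1^2 = B - R
    makes it rational in the remaining quantities.\<close>
  have \<mu>a1: "\<mu> * a1 = (a\<^sup>2 * R * (c\<^sup>2 - 1) - Q * (R - a * (a + a2))) * (B - R) / (a * R * Q)"
  proof -
    have "(\<mu> * a1) * (a * R * Q) = (\<mu> * (a * R * Q)) * a1" by simp
    also have "\<dots> = (a\<^sup>2 * R * (c\<^sup>2 - 1) - Q * (R - a * (a + a2))) * a1\<^sup>2"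
      unfolding \<mu> by (simp add: power2_eq_square)
    finally show ?thesis using ab(1) R(2) Q(2) by (simp add: aa1 nonzero_eq_divide_eq)
  qed
  have drift_term: "\<mu> * (b1 / b - a1 / a)
      = - ((a\<^sup>2 * R * (c\<^sup>2 - 1) - Q * (R - a * (a + a2))) * (B - R) / (a * R * Q) / (a * B))"
  proof -
    have "b1 / b - a1 / a = - (a1 * (a\<^sup>2 + B)) / (a * B)"
      unfolding b1 using ab(1) B by (simp add: field_simps power2_eq_square)
    then have "b1 / b - a1 / a = - a1 / (a * B)" by (simp add: B_def)
    then have "\<mu> * (b1 / b - a1 / a) = - ((\<mu> * a1) / (a * B))" by simp
    then show ?thesis by (simp only: \<mu>a1)
  qed
  have c: "c\<^sup>2 * a\<^sup>2 = Q - B" "a\<^sup>2 * R * (c\<^sup>2 - 1) = (Q - 1) * R"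
    by (simp_all add: Q(1) B_def algebra_simps)
  have a2: "a\<^sup>2 + B = 1" by (simp add: B_def)
  \<comment> \<open>The remaining identity is split into partial fractions until linear arithmetic
    can compare the pieces.\<close>
  have t1: "((B - R) + a * a2 + a\<^sup>2 * (B - R) / B) / B = (B - R) / B\<^sup>2 + a * a2 / B"
  proof -
    have "(B - R) + a\<^sup>2 * (B - R) / B = (a\<^sup>2 + B) * (B - R) / B"
      using B by (simp add: field_simps)
    then have "(B - R) + a\<^sup>2 * (B - R) / B = (B - R) / B" by (simp add: a2)
    then have e: "(B - R) + a * a2 + a\<^sup>2 * (B - R) / B = (B - R) / B + a * a2" by linarith
    show ?thesis unfolding e by (simp add: add_divide_distrib power2_eq_square)
  qed
  have t2: "c\<^sup>2 * a\<^sup>2 * R / (B\<^sup>2 * Q) = R / B\<^sup>2 - R / (B * Q)"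
    unfolding c using B Q(2) by (simp add: field_simps power2_eq_square)
  have t3: "(a\<^sup>2 * R * (c\<^sup>2 - 1) - Q * (R - a * (a + a2))) * (B - R) / (a * R * Q) / (a * B)
      = (a + a2) * (B - R) / (a * B * R) - (B - R) / (a\<^sup>2 * B * Q)"
    unfolding c using B Q(2) R(2) ab(1) by (simp add: field_simps power2_eq_square)
  have t4: "R / (B * Q) + R / (a\<^sup>2 * Q) + (B - R) / (a\<^sup>2 * B * Q) = 1 / (a\<^sup>2 * Q)"
  proof -
    have "R / (B * Q) + R / (a\<^sup>2 * Q) + (B - R) / (a\<^sup>2 * B * Q) = (R * (a\<^sup>2 + B) + (B - R)) / (a\<^sup>2 * B * Q)"
      using B Q(2) ab(1) by (simp add: field_simps)
    then show ?thesis using B by (simp add: a2)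
  qed
  have t5: "(a + a2) * (B - R) / (a * B * R) = (a + a2) / (a * R) - (1 / B + a2 / (a * B))"
    using B R(2) ab(1) by (simp add: field_simps)
  have t6: "(B - R) / B\<^sup>2 + R / B\<^sup>2 = 1 / B"
    using B by (simp add: add_divide_distrib[symmetric] power2_eq_square)
  have t7: "a * a2 / B + a2 / a = a2 / (a * B)"
  proof -
    have "a * a2 / B + a2 / a = a2 * (a\<^sup>2 + B) / (a * B)"
      using B ab(1) by (simp add: field_simps power2_eq_square)
    then show ?thesis by (simp add: a2)
  qed
  show ?thesis
    unfolding b2b w2 s2 drift_term minus_divide_left[symmetric] t1 t2 t3 t5 using t4 t6 t7 by linarith
qed

section \<open>Reconstruction from the radial function\<close>

text \<open>Everything in a harmonic spiral product except the harmonic map equation, so that both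
  directions of the theorem can work inside it.\<close>

locale spiral_profile =
  fixes I :: "real set" and k1 k2 :: nat and a b s1 s2 l1 l2 :: "real \<Rightarrow> real"
  assumes I: "nondegenerate_interval I"
    and smooth: "smooth_on I a" "smooth_on I b" "smooth_on I s1" "smooth_on I s2"
      "smooth_on I l1" "smooth_on I l2"
    and ab_pos: "\<And>t. t \<in> I \<Longrightarrow> 0 < a t" "\<And>t. t \<in> I \<Longrightarrow> 0 < b t"
    and circle: "\<And>t. t \<in> I \<Longrightarrow> (a t)\<^sup>2 + (b t)\<^sup>2 = 1"
    and l_pos: "\<And>t. t \<in> I \<Longrightarrow> 0 < l1 t" "\<And>t. t \<in> I \<Longrightarrow> 0 < l2 t"
begin

text \<open>F as computed from the warps, as opposed to \<open>radial_F\<close>, which is computed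
  from a.\<close>

definition vol :: "real \<Rightarrow> real" where "vol t = l1 t ^ k1 * l2 t ^ k2"

abbreviation "drift \<equiv> spiral_drift I k1 k2 l1 l2"
abbreviation "z1 \<equiv> \<lambda>t. complex_of_real (a t) * cis (s1 t)"
abbreviation "z2 \<equiv> \<lambda>t. complex_of_real (b t) * cis (s2 t)"

lemma vol_pos: "t \<in> I \<Longrightarrow> 0 < vol t"
  by (simp add: vol_def l_pos)

lemma vol_deriv:
  assumes t: "t \<in> I" shows "(vol has_real_derivative drift t * vol t) (at t within I)"
proof -
  have p: "((\<lambda>t. l t ^ k) has_real_derivative (k * deriv_within I l t / l t) * l t ^ k) (at t within I)"
    if l: "smooth_on I l" "0 < l t" for l and k :: nat
  proof -
    have "((\<lambda>t. l t ^ k) has_real_derivative of_nat k * (deriv_within I l t * l t ^ (k - Suc 0))) (at t within I)"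
      by (rule DERIV_power[OF smooth_on_DERIV[OF I l(1) t]])
    moreover have "of_nat k * (deriv_within I l t * l t ^ (k - Suc 0)) = (k * deriv_within I l t / l t) * l t ^ k"
      using l(2) by (cases k) auto
    ultimately show ?thesis by simp
  qed
  show ?thesis
    using DERIV_mult[OF p[OF smooth(5) l_pos(1)[OF t], of k1] p[OF smooth(6) l_pos(2)[OF t], of k2]]
    by (simp add: vol_def[abs_def] spiral_drift_def algebra_simps)
qed

lemma circle_deriv:
  assumes t: "t \<in> I" shows "a t * deriv_within I a t + b t * deriv_within I b t = 0"
proof -
  have "((\<lambda>t. (a t)\<^sup>2 + (b t)\<^sup>2) has_real_derivative
      2 * (a t * deriv_within I a t + b t * deriv_within I b t)) (at t within I)"
    using smooth_on_DERIV[OF I smooth(1) t] smooth_on_DERIV[OF I smooth(2) t]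
    by (auto intro!: derivative_eq_intros)
  then have "2 * (a t * deriv_within I a t + b t * deriv_within I b t) = 0"
    by (rule interval_DERIV_unique[OF I t _ DERIV_const]) (rule circle)
  then show ?thesis by simp
qed

lemma circle_deriv2:
  assumes t: "t \<in> I"
  shows "(deriv_within I a t)\<^sup>2 + a t * deriv_within I (deriv_within I a) t
    + (deriv_within I b t)\<^sup>2 + b t * deriv_within I (deriv_within I b) t = 0"
proof -
  note s' = smooth_on_deriv_within[OF I smooth(1)] smooth_on_deriv_within[OF I smooth(2)]
  have "((\<lambda>t. a t * deriv_within I a t + b t * deriv_within I b t) has_real_derivative
      (deriv_within I a t)\<^sup>2 + a t * deriv_within I (deriv_within I a) t
      + (deriv_within I b t)\<^sup>2 + b t * deriv_within I (deriv_within I b) t) (at t within I)"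
    using smooth_on_DERIV[OF I smooth(1) t] smooth_on_DERIV[OF I smooth(2) t]
      smooth_on_DERIV[OF I s'(1) t] smooth_on_DERIV[OF I s'(2) t]
    by (auto intro!: derivative_eq_intros simp: power2_eq_square)
  then show ?thesis
    by (rule interval_DERIV_unique[OF I t _ DERIV_const]) (rule circle_deriv)
qed

text \<open>The imaginary parts stay as they are; the two real parts collapse to their difference by
  \<open>real_parts_iff_difference\<close>, whose hypotheses are the differentiated circle
  relations.\<close>

lemma spiral_ode_iff:
  assumes t: "t \<in> I"
  shows "spiral_ode I k1 k2 d1 d2 z1 z2 l1 l2 t \<longleftrightarrow>
    2 * deriv_within I a t * deriv_within I s1 t + a t * deriv_within I (deriv_within I s1) t
      + drift t * a t * deriv_within I s1 t = 0 \<and>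
    2 * deriv_within I b t * deriv_within I s2 t + b t * deriv_within I (deriv_within I s2) t
      + drift t * b t * deriv_within I s2 t = 0 \<and>
    d2 / (l2 t)\<^sup>2 - d1 / (l1 t)\<^sup>2 =
      deriv_within I (deriv_within I b) t / b t - deriv_within I (deriv_within I a) t / a t
      - (deriv_within I s2 t)\<^sup>2 + (deriv_within I s1 t)\<^sup>2
      + drift t * (deriv_within I b t / b t - deriv_within I a t / a t)"
proof -
  have "spiral_energy I d1 d2 z1 z2 l1 l2 t =
      (deriv_within I a t)\<^sup>2 + (a t)\<^sup>2 * (deriv_within I s1 t)\<^sup>2
      + ((deriv_within I b t)\<^sup>2 + (b t)\<^sup>2 * (deriv_within I s2 t)\<^sup>2)
      + (a t)\<^sup>2 * (d1 / (l1 t)\<^sup>2) + (b t)\<^sup>2 * (d2 / (l2 t)\<^sup>2)"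
    by (simp add: spiral_energy_def norm_polar_deriv_within[OF I smooth(1,3) t]
        norm_polar_deriv_within[OF I smooth(2,4) t] norm_mult)
  from real_parts_iff_difference[OF ab_pos[OF t] circle[OF t] circle_deriv[OF t] circle_deriv2[OF t] this]
  show ?thesis
    unfolding spiral_ode_def polar_ode_iff[OF I smooth(1,3) t] polar_ode_iff[OF I smooth(2,4) t]
    by blast
qed

text \<open>\<open>vol t * r t\<close> is an integrating factor for the imaginary part of the
  equation; (r, s) stands for (a, s1) or (b, s2).\<close>

lemma momentum_deriv:
  assumes r: "smooth_on I r" and s: "smooth_on I s" and t: "t \<in> I"
  shows "((\<lambda>t. vol t * (r t)\<^sup>2 * deriv_within I s t) has_real_derivative
    vol t * r t * (2 * deriv_within I r t * deriv_within I s t + r t * deriv_within I (deriv_within I s) t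
      + drift t * r t * deriv_within I s t)) (at t within I)"
  using vol_deriv[OF t] smooth_on_DERIV[OF I r t]
    smooth_on_DERIV[OF I smooth_on_deriv_within[OF I s] t]
  by (auto intro!: derivative_eq_intros simp: power2_eq_square algebra_simps)

lemma momentum_const:
  assumes r: "smooth_on I r" and s: "smooth_on I s"
    and ode: "\<And>t. t \<in> I \<Longrightarrow> 2 * deriv_within I r t * deriv_within I s t
      + r t * deriv_within I (deriv_within I s) t + drift t * r t * deriv_within I s t = 0"
  shows "\<exists>C. \<forall>t\<in>I. vol t * (r t)\<^sup>2 * deriv_within I s t = C"
proof (rule interval_DERIV_zero_const[OF I])
  show "((\<lambda>t. vol t * (r t)\<^sup>2 * deriv_within I s t) has_real_derivative 0) (at t within I)"
    if "t \<in> I" for t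
    using momentum_deriv[OF r s that] unfolding ode[OF that] by simp
qed

lemma momentum_ode:
  assumes r: "smooth_on I r" and s: "smooth_on I s" and t: "t \<in> I" and pos: "0 < r t"
    and const: "\<And>t. t \<in> I \<Longrightarrow> vol t * (r t)\<^sup>2 * deriv_within I s t = C"
  shows "2 * deriv_within I r t * deriv_within I s t
      + r t * deriv_within I (deriv_within I s) t + drift t * r t * deriv_within I s t = 0"
proof -
  have "vol t * r t * (2 * deriv_within I r t * deriv_within I s t
      + r t * deriv_within I (deriv_within I s) t + drift t * r t * deriv_within I s t) = 0"
    by (rule interval_DERIV_unique[OF I t momentum_deriv[OF r s t] DERIV_const]) (rule const)
  then show ?thesis using vol_pos[OF t] pos by simp
qed

lemma a_less_1: assumes "t \<in> I" shows "a t < 1"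
proof -
  have "(a t)\<^sup>2 < 1"
    using circle[OF assms] zero_less_power[OF ab_pos(2)[OF assms], of 2] by linarith
  then show ?thesis by (simp add: abs_square_less_1)
qed

lemma radial_Q_pos: assumes "t \<in> I" shows "0 < radial_Q c a t"
proof -
  have "radial_Q c a t = (b t)\<^sup>2 + c\<^sup>2 * (a t)\<^sup>2"
    using circle[OF assms] by (simp add: radial_Q_def algebra_simps)
  then show ?thesis using ab_pos(2)[OF assms] by (simp add: add_pos_nonneg)
qed

text \<open>The momenta enter as assumptions because their constancy has two sources: the prescribed
  phase speeds in the reconstruction and \<open>momentum_const\<close> in the converse.\<close>

context
  fixes c \<epsilon> \<sigma> :: real
  assumes \<epsilon>: "0 < \<epsilon>" and \<sigma>: "\<sigma> \<in> {-1, 1}"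
    and mom1: "\<And>t. t \<in> I \<Longrightarrow> vol t * (a t)\<^sup>2 * deriv_within I s1 t = \<sigma> * sqrt \<epsilon>"
    and mom2: "\<And>t. t \<in> I \<Longrightarrow> vol t * (b t)\<^sup>2 * deriv_within I s2 t = \<sigma> * c * sqrt \<epsilon>"
begin

lemma mom_square:
  assumes "t \<in> I"
  shows "(vol t * (a t)\<^sup>2 * deriv_within I s1 t)\<^sup>2 = \<epsilon>"
    "(vol t * (b t)\<^sup>2 * deriv_within I s2 t)\<^sup>2 = c\<^sup>2 * \<epsilon>"
  unfolding mom1[OF assms] mom2[OF assms] using \<epsilon> \<sigma> by (auto simp: power_mult_distrib)

lemma unit_speed_iff_radial:
  "unit_speed I a b s1 s2 \<longleftrightarrow>
    (\<forall>t\<in>I. (vol t)\<^sup>2 * (a t)\<^sup>2 * radial_R I a t = \<epsilon> * radial_Q c a t)"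
  unfolding unit_speed_iff[OF I smooth(1-4)] radial_R_def radial_Q_def
  by (rule ball_cong[OF refl])
     (rule speed_iff_radial[OF ab_pos circle vol_pos circle_deriv mom_square], assumption+)

text \<open>The radial relation has two sources as well: \<open>radial_F_square\<close> in the
  reconstruction and unit speed in the converse.\<close>

context
  assumes rad: "\<And>t. t \<in> I \<Longrightarrow> (vol t)\<^sup>2 * (a t)\<^sup>2 * radial_R I a t = \<epsilon> * radial_Q c a t"
begin

text \<open>The converse must derive R > 0: the other factors on the left are positive and so is eps
  Q.\<close>

lemma radial_R_pos: assumes "t \<in> I" shows "0 < radial_R I a t"
proof -
  have "0 < (vol t)\<^sup>2 * (a t)\<^sup>2 * radial_R I a t" unfolding rad[OF assms] using \<epsilon> radial_Q_pos[OF assms] by simp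
  then show ?thesis
    by (rule zero_less_mult_pos) (intro mult_pos_pos zero_less_power vol_pos ab_pos assms)
qed

lemma vol_eq_radial_F: assumes "t \<in> I" shows "vol t = radial_F I c \<epsilon> a t"
proof -
  have "(vol t)\<^sup>2 = \<epsilon> * radial_Q c a t / ((a t)\<^sup>2 * radial_R I a t)"
    using rad[OF assms] radial_R_pos[OF assms] ab_pos(1)[OF assms] by (simp add: field_simps)
  then show ?thesis
    using vol_pos[OF assms] unfolding radial_F_def by (simp add: real_sqrt_unique)
qed

text \<open>The radial relation differentiated along I, with F' equal to the drift times F. It
  supplies the hypothesis \<open>drift\<close> of \<open>difference_radial\<close>.\<close>

lemma radial_deriv:
  assumes t: "t \<in> I"
  defines "a1 \<equiv> deriv_within I a t" and "a2 \<equiv> deriv_within I (deriv_within I a) t"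
  shows "2 * drift t * (vol t)\<^sup>2 * (a t)\<^sup>2 * radial_R I a t
      + (vol t)\<^sup>2 * (2 * a t * a1 * radial_R I a t - 2 * (a t)\<^sup>2 * a1 * (a t + a2))
    = \<epsilon> * ((c\<^sup>2 - 1) * (2 * a t * a1))"
proof (rule interval_DERIV_unique[OF I t])
  note da = smooth_on_DERIV[OF I smooth(1) t] smooth_on_DERIV[OF I smooth_on_deriv_within[OF I smooth(1)] t]
  show "((\<lambda>t. (vol t)\<^sup>2 * (a t)\<^sup>2 * radial_R I a t) has_real_derivative
      2 * drift t * (vol t)\<^sup>2 * (a t)\<^sup>2 * radial_R I a t
      + (vol t)\<^sup>2 * (2 * a t * a1 * radial_R I a t - 2 * (a t)\<^sup>2 * a1 * (a t + a2))) (at t within I)"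
    unfolding radial_R_def a1_def a2_def using da vol_deriv[OF t]
    by (auto intro!: derivative_eq_intros simp: power2_eq_square algebra_simps)
  show "((\<lambda>t. \<epsilon> * radial_Q c a t) has_real_derivative \<epsilon> * ((c\<^sup>2 - 1) * (2 * a t * a1))) (at t within I)"
    unfolding radial_Q_def a1_def using da by (auto intro!: derivative_eq_intros)
qed (rule rad)

text \<open>Constant momenta settle the imaginary parts, and \<open>difference_radial\<close>
  evaluates the right-hand side of the remaining equation to T.\<close>

lemma spiral_ode_iff_radial_T:
  assumes t: "t \<in> I"
  shows "spiral_ode I k1 k2 d1 d2 z1 z2 l1 l2 t \<longleftrightarrow> d2 / (l2 t)\<^sup>2 - d1 / (l1 t)\<^sup>2 = radial_T I c a t"
proof -
  have "deriv_within I (deriv_within I b) t / b t - deriv_within I (deriv_within I a) t / a t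
      - (deriv_within I s2 t)\<^sup>2 + (deriv_within I s1 t)\<^sup>2
      + drift t * (deriv_within I b t / b t - deriv_within I a t / a t) = radial_T I c a t"
    unfolding radial_T_def
    by (rule difference_radial[OF ab_pos[OF t] circle[OF t] vol_pos[OF t] \<epsilon> circle_deriv[OF t]
          circle_deriv2[OF t] mom_square[OF t] radial_R_def radial_R_pos[OF t] radial_Q_def
          radial_Q_pos[OF t] rad[OF t] radial_deriv[OF t]])
  then show ?thesis
    unfolding spiral_ode_iff[OF t]
    using momentum_ode[OF smooth(1,3) t ab_pos(1)[OF t] mom1]
      momentum_ode[OF smooth(2,4) t ab_pos(2)[OF t] mom2] by simp
qed

end

end

end

section \<open>Reconstruction from an admissible radius\<close>

lemma admissible_radius_Q_pos:
  assumes "admissible_radius I a" "t \<in> I" shows "0 < radial_Q c a t"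
proof -
  have a: "0 < a t" "a t < 1" using assms by (auto simp: admissible_radius_def)
  then have "(a t)\<^sup>2 < 1" by (simp add: abs_square_less_1)
  moreover have "radial_Q c a t = (1 - (a t)\<^sup>2) + c\<^sup>2 * (a t)\<^sup>2"
    by (simp add: radial_Q_def algebra_simps)
  moreover have "0 \<le> c\<^sup>2 * (a t)\<^sup>2" by simp
  ultimately show ?thesis by linarith
qed

lemma radial_F_pos:
  assumes "admissible_radius I a" "0 < \<epsilon>" "t \<in> I" shows "0 < radial_F I c \<epsilon> a t"
  using assms admissible_radius_Q_pos[OF assms(1,3), of c]
  by (auto simp: radial_F_def admissible_radius_def)

lemma radial_F_square:
  assumes "admissible_radius I a" "0 < \<epsilon>" "t \<in> I"
  shows "(radial_F I c \<epsilon> a t)\<^sup>2 * (a t)\<^sup>2 * radial_R I a t = \<epsilon> * radial_Q c a t"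
proof -
  have "0 < a t" "0 < radial_R I a t" using assms by (auto simp: admissible_radius_def)
  moreover have "0 \<le> \<epsilon> * radial_Q c a t / ((a t)\<^sup>2 * radial_R I a t)"
    using calculation assms(2) admissible_radius_Q_pos[OF assms(1,3), of c] by simp
  ultimately show ?thesis unfolding radial_F_def by simp
qed

lemma smooth_on_radial:
  assumes I: "nondegenerate_interval I" and a: "admissible_radius I a" and \<epsilon>: "0 < \<epsilon>"
  shows "smooth_on I (radial_F I c \<epsilon> a)" "smooth_on I (radial_T I c a)"
proof -
  have sa: "smooth_on I a" and pos: "\<And>t. t \<in> I \<Longrightarrow> 0 < a t" "\<And>t. t \<in> I \<Longrightarrow> 0 < radial_R I a t"
    using a by (auto simp: admissible_radius_def)
  note a1 = smooth_on_deriv_within[OF I sa]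
  note a2 = smooth_on_deriv_within[OF I a1]
  have R: "smooth_on I (radial_R I a)"
    unfolding radial_R_def[abs_def]
    by (rule smooth_on_diff[OF smooth_on_diff[OF smooth_on_const smooth_on_power[OF sa]]
          smooth_on_power[OF a1]])
  have Q: "smooth_on I (radial_Q c a)"
    unfolding radial_Q_def[abs_def]
    by (rule smooth_on_add[OF smooth_on_const smooth_on_mult[OF smooth_on_const smooth_on_power[OF sa]]])
  note Qp = admissible_radius_Q_pos[OF a]
  have "smooth_on I (\<lambda>t. \<epsilon> * radial_Q c a t / ((a t)\<^sup>2 * radial_R I a t))"
    by (rule smooth_on_divide_pos[OF smooth_on_mult[OF smooth_on_const Q]
          smooth_on_mult[OF smooth_on_power[OF sa] R]]) (intro mult_pos_pos zero_less_power pos)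
  then show "smooth_on I (radial_F I c \<epsilon> a)"
    unfolding radial_F_def[abs_def]
    by (rule smooth_on_comp_real[OF _ smooth_on_sqrt_pos, rotated])
       (unfold greaterThan_iff, intro divide_pos_pos mult_pos_pos zero_less_power pos Qp \<epsilon>)
  have "smooth_on I (\<lambda>t. 1 / ((a t)\<^sup>2 * radial_Q c a t))"
    by (rule smooth_on_divide_pos[OF smooth_on_const smooth_on_mult[OF smooth_on_power[OF sa] Q]])
       (intro mult_pos_pos zero_less_power pos Qp)
  moreover have "smooth_on I (\<lambda>t. (a t + deriv_within I (deriv_within I a) t) / (a t * radial_R I a t))"
    by (rule smooth_on_divide_pos[OF smooth_on_add[OF sa a2] smooth_on_mult[OF sa R]])
       (intro mult_pos_pos pos)
  ultimately show "smooth_on I (radial_T I c a)"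
    unfolding radial_T_def[abs_def] by (rule smooth_on_diff)
qed

lemma smooth_on_antiderivative:
  fixes f :: "real \<Rightarrow> real"
  assumes "\<And>t. t \<in> I \<Longrightarrow> (f has_real_derivative f' t) (at t within I)" "smooth_on I f'"
  shows "smooth_on I f"
  by (rule smooth_on_real_bootstrap[where f' = f'])
     (use assms in \<open>simp_all add: Ck_on_of_smooth has_real_derivative_iff_has_vector_derivative\<close>)

lemma admissible_radius_b:
  assumes a: "admissible_radius I a" and b: "\<And>t. t \<in> I \<Longrightarrow> b t = sqrt (1 - (a t)\<^sup>2)"
  shows "smooth_on I b" "\<And>t. t \<in> I \<Longrightarrow> 0 < b t" "\<And>t. t \<in> I \<Longrightarrow> (a t)\<^sup>2 + (b t)\<^sup>2 = 1"
proof -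
  have pos: "0 < 1 - (a t)\<^sup>2" if "t \<in> I" for t
    using a that by (auto simp: admissible_radius_def abs_square_less_1)
  have "smooth_on I (\<lambda>t. sqrt (1 - (a t)\<^sup>2))"
    by (rule smooth_on_comp_real[OF _ smooth_on_sqrt_pos smooth_on_diff[OF smooth_on_const smooth_on_power]])
       (use pos a in \<open>auto simp: admissible_radius_def\<close>)
  then show "smooth_on I b" using smooth_on_cong[of I b "\<lambda>t. sqrt (1 - (a t)\<^sup>2)"] b by simp
  show "0 < b t" "(a t)\<^sup>2 + (b t)\<^sup>2 = 1" if "t \<in> I" for t using pos[OF that] b[OF that] by simp_all
qed

context
  fixes I :: "real set" and k1 k2 :: nat and d1 d2 c \<epsilon> \<sigma> :: real and a :: "real \<Rightarrow> real"
  assumes I: "nondegenerate_interval I" and k: "0 < k1" "0 < k2" and d: "0 < d1" "0 < d2"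
    and \<epsilon>: "0 < \<epsilon>" and a: "admissible_radius I a"
begin

lemma smooth_phase_speed:
  assumes "smooth_on I b" "\<And>t. t \<in> I \<Longrightarrow> 0 < b t"
  shows "smooth_on I (\<lambda>t. C / (radial_F I c \<epsilon> a t * (b t)\<^sup>2))"
  by (rule smooth_on_divide_pos[OF smooth_on_const smooth_on_mult[OF smooth_on_radial(1)[OF I a \<epsilon>]
        smooth_on_power[OF assms(1)]]]) (intro mult_pos_pos zero_less_power radial_F_pos[OF a \<epsilon>] assms(2))

lemma reconstruction_exists:
  "\<exists>b l1 l2 s1 s2. reconstruction I k1 k2 d1 d2 c \<epsilon> \<sigma> a b l1 l2 s1 s2"
proof -
  define b where "b t = sqrt (1 - (a t)\<^sup>2)" for t
  note b = admissible_radius_b[OF a b_def]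
  have sa: "smooth_on I a" "\<And>t. t \<in> I \<Longrightarrow> 0 < a t" using a by (auto simp: admissible_radius_def)
  obtain l1 l2 where l: "\<forall>t\<in>I. 0 < l1 t \<and> 0 < l2 t \<and> l1 t ^ k1 * l2 t ^ k2 = radial_F I c \<epsilon> a t \<and>
      d2 / (l2 t)\<^sup>2 - d1 / (l1 t)\<^sup>2 = radial_T I c a t"
    using warp_pair_smooth_exists[OF k d smooth_on_radial(1)[OF I a \<epsilon>] radial_F_pos[OF a \<epsilon>]
        smooth_on_radial(2)[OF I a \<epsilon>]] by blast
  have anti: "\<exists>S. \<forall>t\<in>I. (S has_real_derivative f t) (at t within I)" if "smooth_on I f" for f
    using interval_antiderivative[of I f] Ck_on_of_smooth[OF that, of 0] I
    by (simp add: nondegenerate_interval_def has_real_derivative_iff_has_vector_derivative)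
  obtain s1 where s1: "\<forall>t\<in>I. (s1 has_real_derivative \<sigma> * sqrt \<epsilon> / (radial_F I c \<epsilon> a t * (a t)\<^sup>2)) (at t within I)"
    using anti[OF smooth_phase_speed[OF sa]] by blast
  obtain s2 where s2: "\<forall>t\<in>I. (s2 has_real_derivative \<sigma> * c * sqrt \<epsilon> / (radial_F I c \<epsilon> a t * (b t)\<^sup>2)) (at t within I)"
    using anti[OF smooth_phase_speed[OF b(1,2)]] by blast
  have "reconstruction I k1 k2 d1 d2 c \<epsilon> \<sigma> a b l1 l2 s1 s2"
    unfolding reconstruction_def using l s1 s2 by (simp add: b_def)
  then show ?thesis by blast
qed

lemma reconstruction_unique:
  assumes r: "reconstruction I k1 k2 d1 d2 c \<epsilon> \<sigma> a b l1 l2 s1 s2"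
    and r': "reconstruction I k1 k2 d1 d2 c \<epsilon> \<sigma> a b' l1' l2' s1' s2'"
  shows "\<forall>t\<in>I. b' t = b t \<and> l1' t = l1 t \<and> l2' t = l2 t"
    and "\<exists>C1 C2. \<forall>t\<in>I. s1' t = s1 t + C1 \<and> s2' t = s2 t + C2"
proof -
  have eq: "b' t = b t \<and> l1' t = l1 t \<and> l2' t = l2 t" if "t \<in> I" for t
  proof -
    note rt = r[unfolded reconstruction_def, rule_format, OF that]
      r'[unfolded reconstruction_def, rule_format, OF that]
    have "l1' t = l1 t \<and> l2' t = l2 t" by (rule warp_pair_unique[OF k d]) (use rt in simp_all)
    then show ?thesis using rt by simp
  qed
  then show "\<forall>t\<in>I. b' t = b t \<and> l1' t = l1 t \<and> l2' t = l2 t" by blast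
  have zero: "((\<lambda>t. s1' t - s1 t) has_real_derivative 0) (at t within I)"
    "((\<lambda>t. s2' t - s2 t) has_real_derivative 0) (at t within I)" if t: "t \<in> I" for t
  proof -
    have "(s1 has_real_derivative \<sigma> * sqrt \<epsilon> / (radial_F I c \<epsilon> a t * (a t)\<^sup>2)) (at t within I)"
      "(s1' has_real_derivative \<sigma> * sqrt \<epsilon> / (radial_F I c \<epsilon> a t * (a t)\<^sup>2)) (at t within I)"
      "(s2 has_real_derivative \<sigma> * c * sqrt \<epsilon> / (radial_F I c \<epsilon> a t * (b t)\<^sup>2)) (at t within I)"
      "(s2' has_real_derivative \<sigma> * c * sqrt \<epsilon> / (radial_F I c \<epsilon> a t * (b' t)\<^sup>2)) (at t within I)"
      using r r' t unfolding reconstruction_def by blast+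
    from DERIV_diff[OF this(2,1)] DERIV_diff[OF this(4,3)]
    show "((\<lambda>t. s1' t - s1 t) has_real_derivative 0) (at t within I)"
      "((\<lambda>t. s2' t - s2 t) has_real_derivative 0) (at t within I)"
      by (simp_all add: eq[OF t])
  qed
  obtain C1 C2 where "\<forall>t\<in>I. s1' t - s1 t = C1" "\<forall>t\<in>I. s2' t - s2 t = C2"
    using interval_DERIV_zero_const[OF I zero(1)] interval_DERIV_zero_const[OF I zero(2)] by blast
  then show "\<exists>C1 C2. \<forall>t\<in>I. s1' t = s1 t + C1 \<and> s2' t = s2 t + C2"
    by (intro exI[of _ C1] exI[of _ C2]) (auto simp: algebra_simps)
qed

text \<open>\<open>reconstruction\<close> demands no smoothness. The warps inherit it because
  uniqueness identifies them with the pair from \<open>warp_pair_smooth_exists\<close>, the phases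
  as antiderivatives of smooth speeds, and b as the root of a positive smooth function.\<close>

lemma reconstruction_profile:
  assumes r: "reconstruction I k1 k2 d1 d2 c \<epsilon> \<sigma> a b l1 l2 s1 s2"
  shows "spiral_profile I a b s1 s2 l1 l2"
proof -
  have sa: "smooth_on I a" "\<And>t. t \<in> I \<Longrightarrow> 0 < a t" using a by (auto simp: admissible_radius_def)
  have bt: "\<And>t. t \<in> I \<Longrightarrow> b t = sqrt (1 - (a t)\<^sup>2)" using r by (simp add: reconstruction_def)
  note b = admissible_radius_b[OF a bt]
  obtain m1 m2 where m: "smooth_on I m1" "smooth_on I m2"
    "\<forall>t\<in>I. 0 < m1 t \<and> 0 < m2 t \<and> m1 t ^ k1 * m2 t ^ k2 = radial_F I c \<epsilon> a t \<and>
      d2 / (m2 t)\<^sup>2 - d1 / (m1 t)\<^sup>2 = radial_T I c a t"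
    using warp_pair_smooth_exists[OF k d smooth_on_radial(1)[OF I a \<epsilon>] radial_F_pos[OF a \<epsilon>]
        smooth_on_radial(2)[OF I a \<epsilon>]] by blast
  have eq: "l1 t = m1 t \<and> l2 t = m2 t" if "t \<in> I" for t
    by (rule warp_pair_unique[OF k d])
       (use r[unfolded reconstruction_def, rule_format, OF that] m(3)[rule_format, OF that] in simp_all)
  show ?thesis
  proof
    show "smooth_on I l1" "smooth_on I l2"
      using smooth_on_cong[of I l1 m1] smooth_on_cong[of I l2 m2] m eq by auto
    show "smooth_on I s1"
      by (rule smooth_on_antiderivative[OF _ smooth_phase_speed[OF sa, of "\<sigma> * sqrt \<epsilon>"]])
         (use r in \<open>simp add: reconstruction_def\<close>)
    show "smooth_on I s2"
      by (rule smooth_on_antiderivative[OF _ smooth_phase_speed[OF b(1,2), of "\<sigma> * c * sqrt \<epsilon>"]])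
         (use r in \<open>unfold reconstruction_def, blast\<close>)
    show "0 < l1 t" "0 < l2 t" if "t \<in> I" for t using r that by (simp_all add: reconstruction_def)
  qed (use I sa b in auto)
qed

text \<open>The prescribed phase speeds give the momenta their constant values and the prescribed F
  satisfies the radial relation, so the equivalences for profiles apply.\<close>

lemma reconstruction_spiral:
  assumes r: "reconstruction I k1 k2 d1 d2 c \<epsilon> \<sigma> a b l1 l2 s1 s2" and \<sigma>: "\<sigma> \<in> {-1, 1}"
  shows "unit_speed I a b s1 s2"
    and "t \<in> I \<Longrightarrow> spiral_ode I k1 k2 d1 d2 (\<lambda>t. complex_of_real (a t) * cis (s1 t))
      (\<lambda>t. complex_of_real (b t) * cis (s2 t)) l1 l2 t"
proof -
  interpret spiral_profile I k1 k2 a b s1 s2 l1 l2 by (rule reconstruction_profile[OF r])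
  have F: "vol t = radial_F I c \<epsilon> a t" if "t \<in> I" for t
    using r that by (simp add: vol_def reconstruction_def)
  have rad: "(vol t)\<^sup>2 * (a t)\<^sup>2 * radial_R I a t = \<epsilon> * radial_Q c a t" if "t \<in> I" for t
    unfolding F[OF that] by (rule radial_F_square[OF a \<epsilon> that])
  have ds: "deriv_within I s1 t = \<sigma> * sqrt \<epsilon> / (vol t * (a t)\<^sup>2)"
    "deriv_within I s2 t = \<sigma> * c * sqrt \<epsilon> / (vol t * (b t)\<^sup>2)" if "t \<in> I" for t
  proof -
    have "(s1 has_real_derivative \<sigma> * sqrt \<epsilon> / (vol t * (a t)\<^sup>2)) (at t within I)"
      "(s2 has_real_derivative \<sigma> * c * sqrt \<epsilon> / (vol t * (b t)\<^sup>2)) (at t within I)"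
      using r that unfolding reconstruction_def F[OF that] by blast+
    then show "deriv_within I s1 t = \<sigma> * sqrt \<epsilon> / (vol t * (a t)\<^sup>2)"
      "deriv_within I s2 t = \<sigma> * c * sqrt \<epsilon> / (vol t * (b t)\<^sup>2)"
      unfolding has_real_derivative_iff_has_vector_derivative
      by (blast intro: deriv_within_eqI[OF I that])+
  qed
  have mom: "vol t * (a t)\<^sup>2 * deriv_within I s1 t = \<sigma> * sqrt \<epsilon>"
    "vol t * (b t)\<^sup>2 * deriv_within I s2 t = \<sigma> * c * sqrt \<epsilon>" if "t \<in> I" for t
    using ds[OF that] vol_pos[OF that] ab_pos[OF that] by auto
  show "unit_speed I a b s1 s2" using unit_speed_iff_radial[OF \<epsilon> \<sigma> mom] rad by blast
  show "spiral_ode I k1 k2 d1 d2 z1 z2 l1 l2 t" if "t \<in> I"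
    using spiral_ode_iff_radial_T[OF \<epsilon> \<sigma> mom rad that] r that by (simp add: reconstruction_def)
qed

end

section \<open>Recovering the data from a harmonic spiral product\<close>

lemma (in spiral_profile) spiral_reconstruction:
  assumes unit: "unit_speed I a b s1 s2"
    and ode: "\<And>t. t \<in> I \<Longrightarrow> spiral_ode I k1 k2 d1 d2 z1 z2 l1 l2 t"
    and s1: "t0 \<in> I" "deriv_within I s1 t0 \<noteq> 0"
  shows "\<exists>c \<epsilon> \<sigma>. \<epsilon> > 0 \<and> \<sigma> \<in> {-1, 1} \<and> admissible_radius I a \<and>
    reconstruction I k1 k2 d1 d2 c \<epsilon> \<sigma> a b l1 l2 s1 s2"
proof -
  obtain m1 where m1: "\<And>t. t \<in> I \<Longrightarrow> vol t * (a t)\<^sup>2 * deriv_within I s1 t = m1"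
    using momentum_const[OF smooth(1,3)] ode spiral_ode_iff by blast
  obtain m2 where m2: "\<And>t. t \<in> I \<Longrightarrow> vol t * (b t)\<^sup>2 * deriv_within I s2 t = m2"
    using momentum_const[OF smooth(2,4)] ode spiral_ode_iff by blast
  \<comment> \<open>The first momentum is constant, so a single point with nonzero phase speed
    decides its value on all of I.\<close>
  have m1_nz: "m1 \<noteq> 0"
    using m1[OF s1(1)] vol_pos[OF s1(1)] ab_pos(1)[OF s1(1)] s1(2) by auto
  \<comment> \<open>These choices are forced by \<open>\<sigma>\<close> sqrt eps = m1 and
    \<open>\<sigma>\<close> c sqrt eps = m2: eps is the squared first momentum,
    \<open>\<sigma>\<close> its sign and c the ratio of the momenta.\<close>
  define \<epsilon> where "\<epsilon> = m1\<^sup>2"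
  define \<sigma> where "\<sigma> = sgn m1"
  define c where "c = m2 / m1"
  have \<epsilon>: "0 < \<epsilon>" and \<sigma>: "\<sigma> \<in> {-1, 1}" using m1_nz by (auto simp: \<epsilon>_def \<sigma>_def sgn_if)
  have "\<sigma> * sqrt \<epsilon> = m1" by (simp add: \<epsilon>_def \<sigma>_def sgn_if abs_if)
  moreover from this have "\<sigma> * c * sqrt \<epsilon> = m2" using m1_nz by (simp add: c_def field_simps)
  ultimately have mom: "vol t * (a t)\<^sup>2 * deriv_within I s1 t = \<sigma> * sqrt \<epsilon>"
    "vol t * (b t)\<^sup>2 * deriv_within I s2 t = \<sigma> * c * sqrt \<epsilon>" if "t \<in> I" for t
    using m1 m2 that by auto
  have rad: "(vol t)\<^sup>2 * (a t)\<^sup>2 * radial_R I a t = \<epsilon> * radial_Q c a t" if "t \<in> I" for t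
    using unit unit_speed_iff_radial[OF \<epsilon> \<sigma> mom] that by blast
  have F: "vol t = radial_F I c \<epsilon> a t" if "t \<in> I" for t
    by (rule vol_eq_radial_F[OF \<epsilon> \<sigma> mom rad that])
  have "admissible_radius I a"
    unfolding admissible_radius_def
    using smooth(1) ab_pos(1) a_less_1 radial_R_pos[OF \<epsilon> \<sigma> mom rad] by blast
  moreover have "reconstruction I k1 k2 d1 d2 c \<epsilon> \<sigma> a b l1 l2 s1 s2"
    unfolding reconstruction_def
  proof (intro ballI conjI)
    fix t assume t: "t \<in> I"
    show "b t = sqrt (1 - (a t)\<^sup>2)"
      using circle[OF t] ab_pos(2)[OF t] by (intro real_sqrt_unique[symmetric]) auto
    show "0 < l1 t" "0 < l2 t" using l_pos[OF t] .
    show "l1 t ^ k1 * l2 t ^ k2 = radial_F I c \<epsilon> a t" using F[OF t] by (simp add: vol_def)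
    show "d2 / (l2 t)\<^sup>2 - d1 / (l1 t)\<^sup>2 = radial_T I c a t"
      using spiral_ode_iff_radial_T[OF \<epsilon> \<sigma> mom rad t] ode[OF t] by blast
    have "deriv_within I s1 t = \<sigma> * sqrt \<epsilon> / (radial_F I c \<epsilon> a t * (a t)\<^sup>2)"
      "deriv_within I s2 t = \<sigma> * c * sqrt \<epsilon> / (radial_F I c \<epsilon> a t * (b t)\<^sup>2)"
      unfolding mom[OF t, symmetric] F[OF t, symmetric]
      using vol_pos[OF t] ab_pos[OF t] by simp_all
    then show "(s1 has_real_derivative \<sigma> * sqrt \<epsilon> / (radial_F I c \<epsilon> a t * (a t)\<^sup>2)) (at t within I)"
      "(s2 has_real_derivative \<sigma> * c * sqrt \<epsilon> / (radial_F I c \<epsilon> a t * (b t)\<^sup>2)) (at t within I)"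
      using smooth_on_DERIV[OF I smooth(3) t] smooth_on_DERIV[OF I smooth(4) t] by simp_all
  qed
  ultimately show ?thesis using \<epsilon> \<sigma> by blast
qed

lemma spiral_profile_harmonic_iff:
  fixes N1 :: "('m1, 'e1::euclidean_space) riem" and N2 :: "('m2, 'e2::euclidean_space) riem"
    and f1 :: "'m1 \<Rightarrow> complex ^ 'n1" and f2 :: "'m2 \<Rightarrow> complex ^ 'n2"
  assumes "riemannian_manifold N1" "riemannian_manifold N2" "eigenmap N1 d1 f1" "eigenmap N2 d2 f2"
    and "nondegenerate_interval I"
  shows "harmonic_spiral_product I N1 N2 f1 f2 a b s1 s2 l1 l2 \<longleftrightarrow>
    spiral_profile I a b s1 s2 l1 l2 \<and>
    (\<forall>t\<in>I. spiral_ode I DIM('e1) DIM('e2) d1 d2 (\<lambda>t. complex_of_real (a t) * cis (s1 t))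
       (\<lambda>t. complex_of_real (b t) * cis (s2 t)) l1 l2 t)"
  using spiral_harmonic_iff[OF assms(1-5), of a b s1 s2 l1 l2] assms(5)
  unfolding harmonic_spiral_product_def spiral_profile_def by blast

theorem theorem4p2:
  fixes N1 :: "('m1, 'e1::euclidean_space) riem" and N2 :: "('m2, 'e2::euclidean_space) riem"
    and f1 :: "'m1 \<Rightarrow> complex ^ 'n1" and f2 :: "'m2 \<Rightarrow> complex ^ 'n2"
    and d1 d2 :: real and I :: "real set"
  assumes "riemannian_manifold N1" and "riemannian_manifold N2"
    and "eigenmap N1 d1 f1" and "eigenmap N2 d2 f2"
    and "nondegenerate_interval I"
  shows
    "(\<forall>c \<epsilon> \<sigma> a. \<epsilon> > 0 \<and> \<sigma> \<in> {-1, 1} \<and> admissible_radius I a \<longrightarrow>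
        (\<exists>b l1 l2 s1 s2. reconstruction I DIM('e1) DIM('e2) d1 d2 c \<epsilon> \<sigma> a b l1 l2 s1 s2) \<and>
        (\<forall>b l1 l2 s1 s2. reconstruction I DIM('e1) DIM('e2) d1 d2 c \<epsilon> \<sigma> a b l1 l2 s1 s2 \<longrightarrow>
           harmonic_spiral_product I N1 N2 f1 f2 a b s1 s2 l1 l2 \<and> unit_speed I a b s1 s2) \<and>
        (\<forall>b l1 l2 s1 s2 b' l1' l2' s1' s2'.
           reconstruction I DIM('e1) DIM('e2) d1 d2 c \<epsilon> \<sigma> a b l1 l2 s1 s2 \<and>
           reconstruction I DIM('e1) DIM('e2) d1 d2 c \<epsilon> \<sigma> a b' l1' l2' s1' s2' \<longrightarrow>
           (\<forall>t\<in>I. b' t = b t \<and> l1' t = l1 t \<and> l2' t = l2 t) \<and>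
           (\<exists>C1 C2. \<forall>t\<in>I. s1' t = s1 t + C1 \<and> s2' t = s2 t + C2)))
     \<and> (\<forall>a b s1 s2 l1 l2.
          harmonic_spiral_product I N1 N2 f1 f2 a b s1 s2 l1 l2 \<and> unit_speed I a b s1 s2 \<and>
          (\<exists>t\<in>I. deriv_within I s1 t \<noteq> 0) \<longrightarrow>
          (\<exists>c \<epsilon> \<sigma>. \<epsilon> > 0 \<and> \<sigma> \<in> {-1, 1} \<and> admissible_radius I a \<and>
             reconstruction I DIM('e1) DIM('e2) d1 d2 c \<epsilon> \<sigma> a b l1 l2 s1 s2))"
proof -
  have d: "0 < d1" "0 < d2" using assms(3,4) by (simp_all add: eigenmap_def)
  have k: "0 < DIM('e1)" "0 < DIM('e2)" by simp_all
  note harmonic_iff = spiral_profile_harmonic_iff[OF assms]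
  show ?thesis
  proof (intro conjI allI impI)
    fix c \<epsilon> \<sigma> :: real and a assume "\<epsilon> > 0 \<and> \<sigma> \<in> {-1, 1} \<and> admissible_radius I a"
    then have \<epsilon>: "0 < \<epsilon>" and \<sigma>: "\<sigma> \<in> {-1, 1}" and a: "admissible_radius I a" by auto
    note h = assms(5) k d \<epsilon> a
    show "\<exists>b l1 l2 s1 s2. reconstruction I DIM('e1) DIM('e2) d1 d2 c \<epsilon> \<sigma> a b l1 l2 s1 s2"
      by (rule reconstruction_exists[OF h])
    fix b l1 l2 s1 s2
    {
      assume r: "reconstruction I DIM('e1) DIM('e2) d1 d2 c \<epsilon> \<sigma> a b l1 l2 s1 s2"
      show "harmonic_spiral_product I N1 N2 f1 f2 a b s1 s2 l1 l2"
        unfolding harmonic_iff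
        using reconstruction_profile[OF h r] reconstruction_spiral(2)[OF h r \<sigma>] by blast
      show "unit_speed I a b s1 s2" by (rule reconstruction_spiral(1)[OF h r \<sigma>])
    }
    fix b' l1' l2' s1' s2'
    assume "reconstruction I DIM('e1) DIM('e2) d1 d2 c \<epsilon> \<sigma> a b l1 l2 s1 s2 \<and>
      reconstruction I DIM('e1) DIM('e2) d1 d2 c \<epsilon> \<sigma> a b' l1' l2' s1' s2'"
    then have r: "reconstruction I DIM('e1) DIM('e2) d1 d2 c \<epsilon> \<sigma> a b l1 l2 s1 s2"
      "reconstruction I DIM('e1) DIM('e2) d1 d2 c \<epsilon> \<sigma> a b' l1' l2' s1' s2'" by auto
    show "\<forall>t\<in>I. b' t = b t \<and> l1' t = l1 t \<and> l2' t = l2 t"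
      "\<exists>C1 C2. \<forall>t\<in>I. s1' t = s1 t + C1 \<and> s2' t = s2 t + C2"
      using reconstruction_unique[OF h r] .
  next
    fix a b s1 s2 l1 l2
    assume *: "harmonic_spiral_product I N1 N2 f1 f2 a b s1 s2 l1 l2 \<and> unit_speed I a b s1 s2 \<and>
      (\<exists>t\<in>I. deriv_within I s1 t \<noteq> 0)"
    then obtain t0 where "t0 \<in> I" "deriv_within I s1 t0 \<noteq> 0" by blast
    then show "\<exists>c \<epsilon> \<sigma>. \<epsilon> > 0 \<and> \<sigma> \<in> {-1, 1} \<and> admissible_radius I a \<and>
      reconstruction I DIM('e1) DIM('e2) d1 d2 c \<epsilon> \<sigma> a b l1 l2 s1 s2"
      using * spiral_profile.spiral_reconstruction[of I a b s1 s2 l1 l2] unfolding harmonic_iff by blast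
  qed
qed

end
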